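(* Let $K=\mathbb{F}_q$, $n\ge 1$, let $K_0\subset K_1\subset\cdots\subset K_n$ be subfields of $K$ with $d_i=|K_i|$, and let $\mathcal X=[K_0\times\cdots\times K_n]\subset\mathbb{P}^n(K)$ be the projective nested product of fields over $K_0,\dots,K_n$. Let $\delta_{\mathcal X}(d)$ denote the minimum distance of $C_{\mathcal X}(d)$. (1) If $d>\sum_{i=1}^n(d_i-1)$, then $\delta_{\mathcal X}(d)=1$. (2) Suppose that either $d_1=\cdots=d_n$ and $1\le d\le\sum_{i=1}^n(d_i-1)$, or there exists a positive integer $r$ (with $r+1\le n$) such that $d_1=d_r<d_{r+1}$ and $1\le d<d_{r+1}$. Then $$\delta_{\mathcal X}(d)=(d_{k+1}-\ell)\,d_{k+2}\cdots d_n,$$ where $0\le k\le n-1$ and $0\le \ell<d_{k+1}-1$ are the unique integers such that $d-1=\sum_{i=1}^k(d_i-1)+\ell$.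
   Context: $[K_0\times\cdots\times K_n]$ denotes the set of points $(a_0:\cdots:a_n)\in\mathbb{P}^n(K)$ with $a_i\in K_i$ for all $i$ (not all zero). Let $S=K[X_0,\dots,X_n]$ and let $S_d$ be the $K$-vector space of homogeneous polynomials of degree $d$ together with $0$. Let $P_1,\dots,P_m$ be the points of $\mathcal X$, each written with its standard representative (first nonzero entry, from the left, equal to $1$). The code $C_{\mathcal X}(d)$ is the image of the evaluation map $\varphi_d:S_d\to K^{|\mathcal X|}$, $f\mapsto(f(P_1),\dots,f(P_m))$, and its minimum distance is $\delta_{\mathcal X}(d)=\min\{|\varphi_d(f)| : f\in S_d,\ \varphi_d(f)\ne 0\}$, where $|\varphi_d(f)|$ is the number of nonzero entries of $\varphi_d(f)$. If $k=n-1$, the empty product $d_{k+2}\cdots d_n$ equals $1$. *)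

theory Defs
  imports Complex_Main "HOL-Library.Poly_Mapping"
begin

definition is_subfield :: "'a::field set \<Rightarrow> bool" where
  "is_subfield F \<longleftrightarrow> 0 \<in> F \<and> 1 \<in> F \<and>
     (\<forall>x\<in>F. \<forall>y\<in>F. x + y \<in> F \<and> x * y \<in> F) \<and>
     (\<forall>x\<in>F. - x \<in> F \<and> inverse x \<in> F)"

(* Vectors (a_0, ..., a_n) are functions on nat, padded with zeros beyond index n. *)
definition vecs :: "nat \<Rightarrow> (nat \<Rightarrow> 'a::zero) set" where
  "vecs n = {a. \<forall>i>n. a i = 0}"

definition nonzero_vecs :: "nat \<Rightarrow> (nat \<Rightarrow> 'a::zero) set" where
  "nonzero_vecs n = vecs n - {\<lambda>_. 0}"

definition proj_rel :: "nat \<Rightarrow> ((nat \<Rightarrow> 'a::field) \<times> (nat \<Rightarrow> 'a)) set" where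
  "proj_rel n = {(a, b). a \<in> nonzero_vecs n \<and> b \<in> nonzero_vecs n \<and>
                         (\<exists>c. c \<noteq> 0 \<and> b = (\<lambda>i. c * a i))}"

definition proj_space :: "nat \<Rightarrow> (nat \<Rightarrow> 'a::field) set set" where
  "proj_space n = nonzero_vecs n // proj_rel n"

definition proj_product :: "nat \<Rightarrow> (nat \<Rightarrow> 'a::field set) \<Rightarrow> (nat \<Rightarrow> 'a) set set" where
  "proj_product n K = {P \<in> proj_space n. \<exists>a\<in>P. \<forall>i\<le>n. a i \<in> K i}"

definition std_rep :: "(nat \<Rightarrow> 'a::field) set \<Rightarrow> nat \<Rightarrow> 'a" where
  "std_rep P = (THE a. a \<in> P \<and> (\<exists>j. a j = 1 \<and> (\<forall>i<j. a i = 0)))"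

(* A polynomial maps each monomial, given by its exponent vector, to its coefficient. *)
type_synonym 'a mpoly = "(nat \<Rightarrow>\<^sub>0 nat) \<Rightarrow>\<^sub>0 'a"

(* The zero polynomial is included, having no monomials. *)
definition homogeneous_polys :: "nat \<Rightarrow> nat \<Rightarrow> 'a::field mpoly set" where
  "homogeneous_polys n d =
     {f. \<forall>m \<in> Poly_Mapping.keys f.
           Poly_Mapping.keys m \<subseteq> {..n} \<and>
           (\<Sum>i\<in>Poly_Mapping.keys m. Poly_Mapping.lookup m i) = d}"

definition poly_eval :: "'a::field mpoly \<Rightarrow> (nat \<Rightarrow> 'a) \<Rightarrow> 'a" where
  "poly_eval f a =
     (\<Sum>m\<in>Poly_Mapping.keys f. Poly_Mapping.lookup f m *
        (\<Prod>i\<in>Poly_Mapping.keys m. a i ^ Poly_Mapping.lookup m i))"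

(* The coordinates of a word are indexed by the points of X themselves rather than by
   an enumeration of them; words are extended by zero outside X. *)
definition eval_map ::
  "(nat \<Rightarrow> 'a::field) set set \<Rightarrow> 'a mpoly \<Rightarrow> (nat \<Rightarrow> 'a) set \<Rightarrow> 'a" where
  "eval_map X f = (\<lambda>P. if P \<in> X then poly_eval f (std_rep P) else 0)"

definition eval_code ::
  "nat \<Rightarrow> (nat \<Rightarrow> 'a::field) set set \<Rightarrow> nat \<Rightarrow> ((nat \<Rightarrow> 'a) set \<Rightarrow> 'a) set" where
  "eval_code n X d = eval_map X ` homogeneous_polys n d"

definition weight ::
  "(nat \<Rightarrow> 'a::field) set set \<Rightarrow> ((nat \<Rightarrow> 'a) set \<Rightarrow> 'a) \<Rightarrow> nat" where
  "weight X w = card {P \<in> X. w P \<noteq> 0}"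

definition min_dist :: "nat \<Rightarrow> (nat \<Rightarrow> 'a::field) set set \<Rightarrow> nat \<Rightarrow> nat" where
  "min_dist n X d = Min {weight X w | w. w \<in> eval_code n X d \<and> w \<noteq> (\<lambda>_. 0)}"

end

theory Submission
  imports Defs "HOL-Computational_Algebra.Polynomial"
begin

text \<open>
  The points of the projective nested product are represented by their standard vectors, so the
  weight of a codeword counts standard vectors where the form $f$ does not vanish. The minimum
  weight is attained by products of $X_0$, binomials $X_0^{d_i-1} - X_i^{d_i-1}$ and linear forms.

  For the lower bound, first let all the fields equal one field $F$ with $q$ elements. Take a maximal
  $F$-subspace $U$ of $F^{r+1}$ on which $f$ vanishes. On every coset $v + U$ with $v \notin U$ the
  form $f$ does not vanish identically, by maximality and homogeneity, and since $f$ vanishes on $U$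
  it agrees there with a polynomial of degree at most $d - 1$ in $\dim U$ variables, to which the
  affine bound of Alon and Fueredi applies.

  If instead the field size jumps to $D > d$ after index $r$, split $f$ by the degree $e$ in the
  variables beyond $r$ and take the largest $e$ whose component $f_e$ does not vanish identically.
  Fixing suitable values of those variables gives a form of degree $d - e$ on $F^{r+1}$, and over each
  of its nonzeros the affine bound counts at least $(D - e) \prod_{i > r+1} d_i$ nonzeros of $f$. The
  two factors recombine to the claimed bound; the case $e = d$ needs $D \ge q^2$.
\<close>

section \<open>Greedy minimum of a product with prescribed deficiency\<close>

text \<open>
  For an ascending list of sizes $d_i$ this is the minimum of $\prod y_i$ subject to
  $1 \le y_i \le d_i$ and $\sum (d_i - y_i) = t$: the smallest sizes are depleted first.
\<close>

fun greedy_min :: "nat list \<Rightarrow> nat \<Rightarrow> nat" where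
  "greedy_min [] t = 1"
| "greedy_min (x # xs) t =
     (if x - 1 \<le> t then greedy_min xs (t - (x - 1)) else (x - t) * prod_list xs)"

lemma greedy_min_0: "\<forall>x\<in>set xs. 0 < x \<Longrightarrow> greedy_min xs 0 = prod_list xs"
proof (induction xs)
  case (Cons x xs)
  then show ?case by (cases "x = 1") auto
qed simp

lemma greedy_min_Cons_less:
  assumes "t < x" "\<forall>y\<in>set xs. 0 < y"
  shows "greedy_min (x # xs) t = (x - t) * prod_list xs"
  using assms greedy_min_0[of xs] by (cases "t = x - 1") auto

text \<open>Returning \<open>v\<close> units of deficiency to an entry \<open>y \<ge> 1\<close>
  multiplies it by \<open>(y + v) / y\<close>, which is at most \<open>v + 1\<close>. When the units
  are spread over two entries, the assumption that all sizes exceed \<open>v\<close> keeps the total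
  factor below the same bound.\<close>

lemma greedy_min_shift:
  assumes "\<forall>x\<in>set xs. v < x" "v \<le> t"
  shows "greedy_min xs (t - v) \<le> (v + 1) * greedy_min xs t"
  using assms
proof (induction xs arbitrary: t)
  case (Cons x xs)
  have pos: "\<forall>y\<in>set xs. 0 < y" using Cons.prems by auto
  consider "x - 1 \<le> t - v" | "t - v < x - 1" "x - 1 \<le> t" | "t < x - 1" by linarith
  then show ?case
  proof cases
    case 1
    then have "greedy_min xs ((t - (x - 1)) - v) \<le> (v + 1) * greedy_min xs (t - (x - 1))"
      by (intro Cons.IH) (use Cons.prems 1 in auto)
    moreover have "t - v - (x - 1) = t - (x - 1) - v" by simp
    moreover have "x - 1 \<le> t" using 1 by simp
    ultimately show ?thesis using 1 by (metis greedy_min.simps(2))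
  next
    case 2
    \<comment> \<open>Here \<open>x\<close> is fully depleted at \<open>t\<close> but not at
      \<open>t - v\<close>; \<open>w\<close> is what deficiency \<open>t\<close> still takes from
      the following entries.\<close>
    define w where "w = t - (x - 1)"
    have w: "w < v" "x - (t - v) = v + 1 - w" using 2 Cons.prems by (auto simp: w_def)
    have "(v + 1 - w) * prod_list xs \<le> (v + 1) * greedy_min xs w"
    proof (cases xs)
      case (Cons y ys)
      have y: "v < y" using Cons.prems Cons by auto
      have "(v + 1 - w) * y \<le> (v + 1) * (y - w)"
      proof -
        obtain a where a: "v = w + a" using w by (metis less_imp_add_positive)
        obtain b where b: "y = v + 1 + b" using y by (metis less_iff_Suc_add add_Suc_right add.commute plus_1_eq_Suc)
        show ?thesis unfolding a b by (simp add: algebra_simps)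
      qed
      then have "(v + 1 - w) * y * prod_list ys \<le> (v + 1) * (y - w) * prod_list ys"
        by (rule mult_right_mono) simp
      moreover have "greedy_min xs w = (y - w) * prod_list ys"
        using Cons w y pos by (simp only: Cons, intro greedy_min_Cons_less) auto
      ultimately show ?thesis using Cons by (simp add: mult.assoc del: mult_Suc)
    qed simp
    then show ?thesis using 2 w by (simp add: w_def del: mult_Suc)
  next
    case 3
    obtain a where a: "x = t + 1 + a" using 3 by (metis less_imp_add_positive less_diff_conv add.assoc add.commute)
    have "x - (t - v) \<le> (v + 1) * (x - t)"
      using Cons.prems(2) by (simp add: a algebra_simps)
    then have "(x - (t - v)) * prod_list xs \<le> (v + 1) * (x - t) * prod_list xs"
      by (rule mult_right_mono) simp
    moreover have "\<not> x - 1 \<le> t - v" "\<not> x - 1 \<le> t" using 3 by auto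
    ultimately show ?thesis by (metis greedy_min.simps(2) mult.assoc)
  qed
qed simp

text \<open>The exchange argument behind the greedy rule: taking only \<open>s\<close> units from
  the smallest size and the other \<open>t - s\<close> from the rest never beats depleting the
  smallest size first. If \<open>x\<close> can be used up, \<open>greedy_min_shift\<close> is
  applied to the \<open>x - 1 - s\<close> units that change place.\<close>

lemma greedy_min_Cons_le:
  assumes "\<forall>y\<in>set xs. x \<le> y" "s < x" "s \<le> t"
  shows "greedy_min (x # xs) t \<le> (x - s) * greedy_min xs (t - s)"
proof (cases "x - 1 \<le> t")
  case True
  have "greedy_min xs (t - s - (x - 1 - s)) \<le> (x - 1 - s + 1) * greedy_min xs (t - s)"
    by (rule greedy_min_shift) (use assms True in auto)
  moreover have "t - s - (x - 1 - s) = t - (x - 1)" "x - 1 - s + 1 = x - s"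
    using assms True by auto
  ultimately show ?thesis using True by (metis greedy_min.simps(2))
next
  case False
  \<comment> \<open>Since \<open>t - s < x \<le> y\<close>, the rest takes its \<open>t - s\<close>
    units from its first entry \<open>y\<close> alone, and moving them over to the smaller
    \<open>x\<close> does not raise the product.\<close>
  have "(x - t) * prod_list xs \<le> (x - s) * greedy_min xs (t - s)"
  proof (cases xs)
    case (Cons y ys)
    obtain a where a: "t = s + a" using assms(3) by (metis le_iff_add)
    obtain b where b: "x = t + 1 + b" using False by (metis less_imp_add_positive not_le less_diff_conv add.assoc add.commute)
    obtain c where c: "y = x + c" using assms(1) Cons by (metis le_iff_add list.set_intros(1))
    have "(x - t) * y \<le> (x - s) * (y - (t - s))"
      unfolding c b a by (simp add: algebra_simps)
    then have "(x - t) * y * prod_list ys \<le> (x - s) * (y - (t - s)) * prod_list ys"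
      by (rule mult_right_mono) simp
    moreover have "greedy_min xs (t - s) = (y - (t - s)) * prod_list ys"
      unfolding Cons by (rule greedy_min_Cons_less) (use assms Cons False in auto)
    ultimately show ?thesis using Cons by (simp add: mult.assoc)
  qed (use assms False in simp)
  then show ?thesis using False by simp
qed

lemma greedy_min_antimono:
  assumes "\<forall>x\<in>set xs. 0 < x" "s \<le> t"
  shows "greedy_min xs t \<le> greedy_min xs s"
  using assms
proof (induction xs arbitrary: s t)
  case (Cons x xs)
  have *: "greedy_min xs u \<le> prod_list xs" for u
    using Cons.IH[of 0 u] Cons.prems greedy_min_0[of xs] by simp
  consider "x - 1 \<le> s" | "s < x - 1" "x - 1 \<le> t" | "t < x - 1" by linarith
  then show ?case
  proof cases
    case 1
    then show ?thesis using Cons by auto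
  next
    case 2
    have "1 * greedy_min xs (t - (x - 1)) \<le> (x - s) * prod_list xs"
      by (rule mult_mono[OF _ *]) (use 2 in auto)
    then show ?thesis using 2 by simp
  next
    case 3
    have "(x - t) * prod_list xs \<le> (x - s) * prod_list xs"
      using Cons.prems by (intro mult_right_mono) auto
    then show ?thesis using 3 Cons.prems by simp
  qed
qed simp

text \<open>The greedy value is a minimum, so it is at most the product obtained by prescribing
  \<open>e\<close> units for \<open>ys\<close> and \<open>t - e\<close> for \<open>xs\<close>. This
  is the form in which two separately proved counts are recombined.\<close>

lemma greedy_min_append_le:
  assumes "sorted (xs @ ys)" "\<forall>x\<in>set (xs @ ys). 0 < x" "e \<le> t"
  shows "greedy_min (xs @ ys) t \<le> greedy_min xs (t - e) * greedy_min ys e"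
  using assms
proof (induction xs arbitrary: t)
  case Nil
  then show ?case using greedy_min_antimono by auto
next
  case (Cons x xs)
  show ?case
  proof (cases "x - 1 \<le> t - e")
    case True
    have "greedy_min (xs @ ys) (t - (x - 1)) \<le> greedy_min xs (t - (x - 1) - e) * greedy_min ys e"
      by (rule Cons.IH) (use Cons.prems True in \<open>auto\<close>)
    moreover have "t - (x - 1) - e = t - e - (x - 1)" by simp
    ultimately show ?thesis using True Cons.prems by simp
  next
    case False
    \<comment> \<open>The entry \<open>x\<close> absorbs the whole share \<open>t - e\<close> of its
      block, so the other entries of that block stay intact and exactly \<open>e\<close> units are
      left.\<close>
    have "greedy_min (x # xs @ ys) t \<le> (x - (t - e)) * greedy_min (xs @ ys) (t - (t - e))"
      by (rule greedy_min_Cons_le) (use Cons.prems False in \<open>auto\<close>)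
    also have "\<dots> \<le> (x - (t - e)) * (greedy_min xs (e - e) * greedy_min ys e)"
      using Cons.IH[of e] Cons.prems by (intro mult_left_mono) auto
    finally show ?thesis using False Cons.prems greedy_min_0[of xs]
      by (simp add: mult.assoc)
  qed
qed

text \<open>The first \<open>k\<close> sizes drop to 1, the next one loses \<open>l\<close>, and the
  others stay whole. The starting index \<open>j\<close> is variable because the induction on
  \<open>k\<close> moves it.\<close>

lemma greedy_min_explicit:
  fixes c :: "nat \<Rightarrow> nat"
  assumes "j + k < m" "l < c (j + k) - 1"
  shows "greedy_min (map c [j..<m]) ((\<Sum>i=j..<j+k. c i - 1) + l)
    = (c (j + k) - l) * (\<Prod>i=j+k+1..<m. c i)"
  using assms
proof (induction k arbitrary: j)
  case 0
  then show ?case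
    by (subst upt_conv_Cons) (auto simp: prod.distinct_set_conv_list[symmetric])
next
  case (Suc k)
  have "(\<Sum>i=j..<j + Suc k. c i - 1) = (c j - 1) + (\<Sum>i=Suc j..<Suc j + k. c i - 1)"
    by (simp add: sum.atLeast_Suc_lessThan)
  then show ?case
    using Suc.prems Suc.IH[of "Suc j"]
    by (subst upt_conv_Cons) (auto simp: algebra_simps)
qed

lemma greedy_min_replicate:
  assumes "k \<le> r" "2 \<le> q"
  shows "greedy_min (replicate r q) (k * (q - 1)) = q ^ (r - k)"
  using assms
proof (induction r arbitrary: k)
  case (Suc r)
  then show ?case by (cases k) auto
qed simp

text \<open>This serves the component that involves only the variables beyond \<open>r\<close>.
  There the size \<open>D\<close> loses \<open>d\<close> units while the total deficiency is
  \<open>d - 1\<close>, so \<open>greedy_min_append_le\<close> does not give the bound. The surplus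
  of \<open>q ^ (r + 1) - 1\<close> over \<open>(q - 1) * q ^ r\<close> has to make up for the
  missing unit.\<close>

lemma greedy_min_replicate_append_bound:
  fixes q r D d :: nat
  assumes q: "2 \<le> q" and D: "q\<^sup>2 \<le> D" and r: "1 \<le> r" and d: "1 \<le> d" "d < D"
    and zs: "sorted (D # zs)"
  shows "(q - 1) * greedy_min (replicate r q @ D # zs) (d - 1)
    \<le> (q ^ (r + 1) - 1) * ((D - d) * prod_list zs)"
proof -
  let ?P = "prod_list zs"
  let ?M = "greedy_min (replicate r q @ D # zs) (d - 1)"
  define x where "x = D - d"
  have cast: "int (q - 1) = int q - 1" "int (q ^ (r + 1) - 1) = int q * int q ^ r - 1"
    using q by (auto simp: of_nat_diff one_le_power)
  have x: "1 \<le> x" using d by (simp add: x_def)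
  have qD: "q \<le> D" using q D by (metis le_trans power2_nat_le_imp_le power2_eq_square le_square)
  have zpos: "\<forall>y\<in>set zs. 0 < y" using zs d by fastforce
  \<comment> \<open>Each way of depleting \<open>k\<close> copies of \<open>q\<close> and taking the
    remaining \<open>e\<close> units from \<open>D\<close> gives an upper bound for the greedy
    minimum.\<close>
  have M_le: "?M \<le> q ^ (r - k) * ((D - e) * ?P)" if "k \<le> r" "d - 1 = k * (q - 1) + e" for k e
  proof -
    have "?M \<le> greedy_min (replicate r q) (d - 1 - e) * greedy_min (D # zs) e"
      by (rule greedy_min_append_le) (use that zs zpos qD q d in \<open>auto simp: sorted_append\<close>)
    moreover have "greedy_min (D # zs) e = (D - e) * ?P"
      by (rule greedy_min_Cons_less) (use that zpos d in auto)
    moreover have "d - 1 - e = k * (q - 1)" using that by simp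
    ultimately show ?thesis using greedy_min_replicate that q by simp
  qed
  have "\<exists>B. ?M \<le> B * ?P \<and> (q - 1) * B \<le> (q ^ (r + 1) - 1) * x"
  proof -
    \<comment> \<open>If \<open>x = D - d\<close> is at least \<open>q\<close>, all units are taken
      from \<open>D\<close>. Otherwise as many copies of \<open>q\<close> as possible are depleted:
      all \<open>r\<close> of them, or only some \<open>k < r\<close>.\<close>
    consider "q \<le> x" | "x < q" "r \<le> (d - 1) div (q - 1)" | "x < q" "(d - 1) div (q - 1) < r"
      by linarith
    then show ?thesis
    proof cases
      case 1
      have "?M \<le> q ^ r * ((D - (d - 1)) * ?P)" using M_le[of 0 "d - 1"] by simp
      moreover have "D - (d - 1) = x + 1" using d by (simp add: x_def)
      ultimately have "?M \<le> (q ^ r * (x + 1)) * ?P" by (metis mult.assoc)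
      moreover have "(q - 1) * (q ^ r * (x + 1)) \<le> (q ^ (r + 1) - 1) * x"
      proof -
        have "q ^ 1 \<le> q ^ r" using q r by (intro power_increasing) auto
        define Q where "Q = int q ^ r"
        from \<open>q ^ 1 \<le> q ^ r\<close> have "int q \<le> Q" by (metis Q_def of_nat_power of_nat_le_iff power_one_right)
        moreover have "int q * (Q - 1) \<le> int x * (Q - 1)"
          using 1 q by (intro mult_right_mono) (auto simp: Q_def one_le_power)
        ultimately have "(int q - 1) * (Q * (int x + 1)) \<le> (int q * Q - 1) * int x"
          by (simp add: algebra_simps)
        then have "int ((q - 1) * (q ^ r * (x + 1))) \<le> int ((q ^ (r + 1) - 1) * x)"
          by (simp only: of_nat_mult of_nat_add of_nat_1 of_nat_power cast Q_def)
        then show ?thesis by (simp only: of_nat_le_iff)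
      qed
      ultimately show ?thesis by blast
    next
      case 2
      then have le: "r * (q - 1) \<le> d - 1" using q
        by (metis div_times_less_eq_dividend le_trans mult_le_mono1)
      have "?M \<le> q ^ (r - r) * ((D - (d - 1 - r * (q - 1))) * ?P)"
        by (rule M_le) (use le in auto)
      moreover have "D - (d - 1 - r * (q - 1)) = x + 1 + r * (q - 1)" using le d by (simp add: x_def)
      moreover have "(q - 1) * (x + 1 + r * (q - 1)) \<le> (q ^ (r + 1) - 1) * x"
      proof -
        have bern: "1 + int r * (int q - 1) \<le> int q ^ r"
        proof -
          have "1 + real r * (real q - 1) \<le> real q ^ r"
            using Bernoulli_inequality[of "real q - 1" r] q by simp
          then have "real_of_int (1 + int r * (int q - 1)) \<le> real_of_int (int q ^ r)" by simp
          then show ?thesis by (simp only: of_int_le_iff)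
        qed
        have "(int q - 1) * (1 + int r * (int q - 1)) \<le> int q * (int r * (int q - 1))"
        proof -
          have "(int q - 1) * (1 + int r * (int q - 1)) \<le> (int q - 1) * (int q * int r)"
            using q r by (intro mult_left_mono) (auto simp: algebra_simps)
          then show ?thesis by (simp add: mult_ac)
        qed
        also have "\<dots> \<le> int q * (int q ^ r - 1)"
          using bern by (intro mult_left_mono) auto
        also have "\<dots> \<le> int q * (int q ^ r - 1) * int x"
          using x q mult_left_mono[of 1 "int x" "int q * (int q ^ r - 1)"]
          by (simp add: one_le_power)
        finally have "(int q - 1) * (int x + 1 + int r * (int q - 1)) \<le> (int q * int q ^ r - 1) * int x"
          by (simp add: algebra_simps)
        then have "int ((q - 1) * (x + 1 + r * (q - 1))) \<le> int ((q ^ (r + 1) - 1) * x)"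
          by (simp only: of_nat_mult of_nat_add of_nat_1 of_nat_power cast)
        then show ?thesis by (simp only: of_nat_le_iff)
      qed
      ultimately show ?thesis by (metis diff_self_eq_0 power_0 mult_1)
    next
      case 3
      define k l where "k = (d - 1) div (q - 1)" and "l = (d - 1) mod (q - 1)"
      have kl: "d - 1 = k * (q - 1) + l" "l < q - 1"
        using q unfolding k_def l_def by (simp_all only: div_mult_mod_eq) simp
      \<comment> \<open>Since \<open>x < q\<close>, one has \<open>d - 1 \<ge> D - q\<close>, and
        \<open>q\<^sup>2 \<le> D\<close> turns this into at least \<open>q\<close> depleted
        copies.\<close>
      have "q * (q - 1) \<le> d - 1"
        using D 3 d q by (simp add: x_def power2_eq_square algebra_simps)
      then have "q \<le> k" using q unfolding k_def by (simp add: less_eq_div_iff_mult_less_eq)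
      then have k2: "2 \<le> k" using q by simp
      \<comment> \<open>From \<open>l \<le> q - 2\<close> and \<open>x \<le> q - 1\<close>. The
        resulting bound on \<open>D\<close> is at most \<open>q ^ k\<close>, by induction from
        \<open>4 * (q - 1) \<le> q ^ 2\<close>, so the \<open>k\<close> depleted copies of
        \<open>q\<close> outweigh the whole factor \<open>D\<close>.\<close>
      have "D \<le> k * (q - 1) + 2 * (q - 1)" using kl 3(1) d q unfolding x_def by linarith
      then have "D \<le> (k + 2) * (q - 1)" by (simp only: add_mult_distrib)
      also have "\<dots> \<le> q ^ k" using k2
      proof (induction k rule: dec_induct)
        case base
        have "0 \<le> (int q - 2)\<^sup>2" by simp
        then have "4 * (int q - 1) \<le> int q ^ 2" by (simp add: power2_eq_square algebra_simps)
        then have "int (4 * (q - 1)) \<le> int (q ^ 2)" using q by (simp add: of_nat_diff)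
        then have "4 * (q - 1) \<le> q ^ 2" by (simp only: of_nat_le_iff)
        then show ?case by simp
      next
        case (step m)
        have "(Suc m + 2) * (q - 1) \<le> (2 * (m + 2)) * (q - 1)" by (rule mult_right_mono) auto
        then have "(Suc m + 2) * (q - 1) \<le> 2 * ((m + 2) * (q - 1))" by (simp only: mult.assoc)
        also have "\<dots> \<le> q * q ^ m" using step q by (intro mult_mono) auto
        finally show ?case by simp
      qed
      finally have Dq: "D \<le> q ^ k" .
      have "?M \<le> q ^ (r - k) * ((D - l) * ?P)" by (rule M_le) (use kl 3 k_def in auto)
      also have "\<dots> \<le> q ^ (r - k) * (q ^ k * ?P)" using Dq by (intro mult_left_mono mult_right_mono) auto
      also have "\<dots> = q ^ r * ?P" using 3 by (simp add: k_def power_add[symmetric] mult.assoc[symmetric])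
      finally have "?M \<le> q ^ r * ?P" .
      moreover have "(q - 1) * q ^ r \<le> (q ^ (r + 1) - 1) * x"
      proof -
        have "(q - 1) * q ^ r \<le> q ^ (r + 1) - 1"
          using q by (simp add: algebra_simps diff_le_mono2 one_le_power)
        also have "\<dots> \<le> (q ^ (r + 1) - 1) * x" using x by simp
        finally show ?thesis .
      qed
      ultimately show ?thesis by blast
    qed
  qed
  then obtain B where B: "?M \<le> B * ?P" "(q - 1) * B \<le> (q ^ (r + 1) - 1) * x" by blast
  have "(q - 1) * ?M \<le> (q - 1) * B * ?P" using B(1) by (simp add: mult.assoc)
  also have "\<dots> \<le> (q ^ (r + 1) - 1) * x * ?P" using B(2) by (rule mult_right_mono) simp
  finally show ?thesis by (simp add: x_def mult.assoc)
qed

section \<open>Polynomial functions of bounded degree and the affine bound\<close>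

text \<open>
  Only an upper bound $t$ for the degree of some representing polynomial is recorded, so nothing
  depends on the representation being unique.
\<close>

inductive poly_fun :: "nat set \<Rightarrow> nat \<Rightarrow> ((nat \<Rightarrow> 'a::field) \<Rightarrow> 'a) \<Rightarrow> bool" for I where
  const: "poly_fun I t (\<lambda>_. c)"
| var: "i \<in> I \<Longrightarrow> poly_fun I t f \<Longrightarrow> poly_fun I (Suc t) (\<lambda>x. x i * f x)"
| add: "poly_fun I t f \<Longrightarrow> poly_fun I t g \<Longrightarrow> poly_fun I t (\<lambda>x. f x + g x)"

lemma poly_fun_mono: "poly_fun I t f \<Longrightarrow> t \<le> t' \<Longrightarrow> I \<subseteq> J \<Longrightarrow> poly_fun J t' f"
proof (induction arbitrary: t' rule: poly_fun.induct)
  case (var i t f)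
  then obtain u where "t' = Suc u" "t \<le> u" by (cases t') auto
  then show ?case using var by (auto intro: poly_fun.var)
qed (auto intro: poly_fun.intros)

lemma poly_fun_cmult: "poly_fun I t f \<Longrightarrow> poly_fun I t (\<lambda>x. c * f x)"
proof (induction rule: poly_fun.induct)
  case (var i t f)
  then have "poly_fun I (Suc t) (\<lambda>x. x i * (c * f x))" by (intro poly_fun.var)
  then show ?case by (simp add: mult.left_commute)
next
  case (add t f g)
  then show ?case using poly_fun.add[OF add.IH] by (simp add: distrib_left)
qed (rule poly_fun.const)

lemma poly_fun_sum: "(\<And>s. s \<in> S \<Longrightarrow> poly_fun I t (f s)) \<Longrightarrow> poly_fun I t (\<lambda>x. \<Sum>s\<in>S. f s x)"
  by (induction S rule: infinite_finite_induct) (auto intro: poly_fun.intros)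

lemma poly_fun_mult:
  "poly_fun I s f \<Longrightarrow> poly_fun I t g \<Longrightarrow> poly_fun I (s + t) (\<lambda>x. f x * g x)"
proof (induction rule: poly_fun.induct)
  case (const u c)
  then show ?case using poly_fun_mono[OF poly_fun_cmult] by (metis le_add2 subset_refl)
next
  case (var i u f)
  then have "poly_fun I (Suc (u + t)) (\<lambda>x. x i * (f x * g x))" by (intro poly_fun.var)
  then show ?case by (simp add: mult.assoc)
next
  case (add u f h)
  then show ?case using poly_fun.add[OF add.IH(1,2)] by (simp add: distrib_right)
qed

lemma poly_fun_linear: "i \<in> I \<Longrightarrow> poly_fun I 1 (\<lambda>x. x i * c)"
  using poly_fun.var[of i I 0 "\<lambda>_. c"] by (simp add: poly_fun.const)

lemma poly_fun_subst:
  assumes "poly_fun I t f" "\<And>i. i \<in> I \<Longrightarrow> poly_fun J 1 (L i)"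
  shows "poly_fun J t (\<lambda>y. f (\<lambda>i. L i y))"
  using assms
proof (induction rule: poly_fun.induct)
  case (var i t f)
  then show ?case using poly_fun_mult[of J 1 "L i" t] by simp
qed (auto intro: poly_fun.intros)

lemma poly_fun_fix_var:
  assumes "poly_fun I t f"
  shows "poly_fun (I - {j}) t (\<lambda>x. f (x(j := c)))"
proof -
  have "poly_fun (I - {j}) t (\<lambda>x. f (\<lambda>i. if i = j then c else x i))"
  proof (rule poly_fun_subst[OF assms])
    fix i assume "i \<in> I"
    then show "poly_fun (I - {j}) 1 (\<lambda>x. if i = j then c else x i)"
      using poly_fun_linear[of i "I - {j}" 1] by (cases "i = j") (auto intro: poly_fun.const)
  qed
  then show ?thesis by (simp add: fun_upd_def)
qed

text \<open>Synthetic division by \<open>x j - c\<close>, by induction on the construction of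
  \<open>f\<close>. The case \<open>t = 0\<close> is separate because truncated subtraction would
  otherwise allow a nonzero constant as quotient.\<close>

lemma poly_fun_divide:
  assumes "poly_fun I t f"
  shows "\<exists>g. (if t = 0 then g = (\<lambda>_. 0) else poly_fun I (t - 1) g) \<and>
    (\<forall>x. f x = f (x(j := c)) + (x j - c) * g x)"
  using assms
proof (induction rule: poly_fun.induct)
  case (const t b)
  then show ?case by (intro exI[of _ "\<lambda>_. 0"]) (auto intro: poly_fun.const)
next
  case (add t f h)
  then obtain g k where
    g: "if t = 0 then g = (\<lambda>_. 0) else poly_fun I (t - 1) g" "\<And>x. f x = f (x(j := c)) + (x j - c) * g x" and
    k: "if t = 0 then k = (\<lambda>_. 0) else poly_fun I (t - 1) k" "\<And>x. h x = h (x(j := c)) + (x j - c) * k x"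
    by metis
  show ?case
  proof (intro exI[of _ "\<lambda>x. g x + k x"] conjI allI)
    fix x
    show "f x + h x = f (x(j := c)) + h (x(j := c)) + (x j - c) * (g x + k x)"
      by (subst g(2)[of x], subst k(2)[of x]) (simp add: algebra_simps)
  qed (use g k in \<open>auto intro: poly_fun.add split: if_splits\<close>)
next
  case (var i t f)
  then obtain g where
    g: "if t = 0 then g = (\<lambda>_. 0) else poly_fun I (t - 1) g" "\<And>x. f x = f (x(j := c)) + (x j - c) * g x"
    by metis
  have xg: "poly_fun I t (\<lambda>x. x i * g x)"
  proof (cases t)
    case 0
    then show ?thesis using g(1) by (simp add: poly_fun.const)
  next
    case (Suc u)
    then show ?thesis using g(1) poly_fun.var[OF var.hyps(1)] by simp
  qed
  show ?case
  proof (cases "i = j")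
    case False
    show ?thesis
    proof (intro exI[of _ "\<lambda>x. x i * g x"] conjI allI)
      fix x
      show "x i * f x = (x(j := c)) i * f (x(j := c)) + (x j - c) * (x i * g x)"
        using False by (subst g(2)[of x]) (simp add: algebra_simps)
    qed (use xg in simp)
  next
    case True
    have cg: "poly_fun I t (\<lambda>x. c * g x)"
      using g(1) by (cases "t = 0") (auto intro: poly_fun.const poly_fun_mono poly_fun_cmult)
    show ?thesis
    \<comment> \<open>The quotient comes from writing \<open>x j * f x\<close> as
      \<open>(x j - c) * f x + c * f x\<close> and dividing the second summand by means of
      \<open>g\<close>.\<close>
    proof (intro exI[of _ "\<lambda>x. f x + c * g x"] conjI allI)
      fix x
      have "c * f x = c * f (x(j := c)) + c * ((x j - c) * g x)"
        by (subst g(2)[of x]) (simp add: algebra_simps)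
      then show "x i * f x = (x(j := c)) i * f (x(j := c)) + (x j - c) * (f x + c * g x)"
        using True by (simp add: algebra_simps)
    qed (use cg var.hyps in \<open>auto intro: poly_fun.add\<close>)
  qed
qed

section \<open>The Alon-Fueredi bound on finite boxes\<close>

definition box :: "nat set \<Rightarrow> (nat \<Rightarrow> 'a::zero set) \<Rightarrow> (nat \<Rightarrow> 'a) set" where
  "box I A = {x. (\<forall>i\<in>I. x i \<in> A i) \<and> (\<forall>i. i \<notin> I \<longrightarrow> x i = 0)}"

lemma box_insert:
  "j \<notin> I \<Longrightarrow> box (insert j I) A = (\<lambda>(a, x). x(j := a)) ` (A j \<times> box I A)"
proof (intro equalityI subsetI)
  fix x assume "j \<notin> I" "x \<in> box (insert j I) A"
  then have "x = (\<lambda>(a, x). x(j := a)) (x j, x(j := 0))" "(x j, x(j := 0)) \<in> A j \<times> box I A"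
    by (auto simp: box_def)
  then show "x \<in> (\<lambda>(a, x). x(j := a)) ` (A j \<times> box I A)" by (rule image_eqI)
qed (auto simp: box_def)

lemma inj_on_box_update: "j \<notin> I \<Longrightarrow> inj_on (\<lambda>(a, x). x(j := a)) (A j \<times> box I A)"
  unfolding inj_on_def box_def
  by (auto simp: fun_upd_def fun_eq_iff)

lemma finite_box: "finite I \<Longrightarrow> (\<And>i. i \<in> I \<Longrightarrow> finite (A i)) \<Longrightarrow> finite (box I A)"
proof (induction I rule: finite_induct)
  case empty
  have "box {} A = {\<lambda>_. 0}" by (auto simp: box_def)
  then show ?case by simp
qed (simp add: box_insert)

lemma card_box: "finite I \<Longrightarrow> card (box I A) = (\<Prod>i\<in>I. card (A i))"
proof (induction I rule: finite_induct)
  case empty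
  have "box {} A = {\<lambda>_. 0}" by (auto simp: box_def)
  then show ?case by simp
next
  case (insert j I)
  then show ?case
    by (simp add: box_insert card_image[OF inj_on_box_update] card_cartesian_product)
qed

text \<open>Roots in the variable \<open>x j\<close> are split off one at a time: after division by
  the factors of the earlier roots \<open>b\<close>, the quotient still vanishes at
  \<open>a\<close>, because each \<open>a - b\<close> is nonzero.\<close>

lemma poly_fun_factor_out:
  assumes f: "poly_fun I t f" and fin: "finite Z"
    and zero: "\<And>x. x \<in> B \<Longrightarrow> x j \<in> Z \<Longrightarrow> f x = 0"
    and B: "\<And>x a. x \<in> B \<Longrightarrow> a \<in> Z \<Longrightarrow> x(j := a) \<in> B"
    and nz: "\<exists>x\<in>B. f x \<noteq> 0"
  shows "\<exists>g. card Z \<le> t \<and> poly_fun I (t - card Z) g \<and>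
    (\<forall>x\<in>B. f x = (\<Prod>a\<in>Z. x j - a) * g x)"
  using fin zero B
proof (induction Z rule: finite_induct)
  case empty
  then show ?case using f by (intro exI[of _ f]) auto
next
  case (insert a Z)
  then obtain g where g: "card Z \<le> t" "poly_fun I (t - card Z) g"
    "\<And>x. x \<in> B \<Longrightarrow> f x = (\<Prod>a\<in>Z. x j - a) * g x" by (metis insertCI)
  obtain h where h: "if t - card Z = 0 then h = (\<lambda>_. 0) else poly_fun I (t - card Z - 1) h"
    "\<And>x. g x = g (x(j := a)) + (x j - a) * h x"
    using poly_fun_divide[OF g(2), of j a] by metis
  have g0: "g (x(j := a)) = 0" if "x \<in> B" for x
  proof -
    have "x(j := a) \<in> B" by (rule insert.prems(2)) (use that in auto)
    moreover from this have "f (x(j := a)) = 0" by (rule insert.prems(1)) simp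
    ultimately have "(\<Prod>b\<in>Z. a - b) * g (x(j := a)) = 0"
      using g(3)[of "x(j := a)"] by simp
    then show ?thesis using insert.hyps by auto
  qed
  have fh: "f x = (\<Prod>b\<in>insert a Z. x j - b) * h x" if "x \<in> B" for x
  proof -
    have "g x = (x j - a) * h x" using h(2)[of x] g0[OF that] by simp
    then show ?thesis using g(3)[OF that] insert.hyps by (simp add: mult_ac)
  qed
  \<comment> \<open>If the degree were already used up, the quotient \<open>h\<close> would be zero
    and \<open>f\<close> would vanish on all of \<open>B\<close>.\<close>
  have "t - card Z \<noteq> 0" using h(1) fh nz by (auto split: if_splits)
  then show ?case using h(1) fh insert.hyps by (intro exI[of _ h]) auto
qed

text \<open>Induction on the number of coordinates. The values of the first coordinate on which
  \<open>f\<close> vanishes identically form \<open>Z\<close>, and their linear factors lower the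
  degree by \<open>card Z\<close>. Each of the other slices obeys the bound for the smaller degree,
  and \<open>greedy_min_Cons_le\<close> with \<open>s = card Z\<close> sums them up; sortedness puts
  the smallest set first, as that lemma requires.\<close>

lemma affine_nonzeros:
  fixes A :: "nat \<Rightarrow> 'a::field set"
  assumes "poly_fun {j..<j+m} t f" "\<exists>x\<in>box {j..<j+m} A. f x \<noteq> 0"
    and "sorted (map (\<lambda>i. card (A i)) [j..<j+m])" "\<And>i. i \<in> {j..<j+m} \<Longrightarrow> finite (A i)"
  shows "greedy_min (map (\<lambda>i. card (A i)) [j..<j+m]) t \<le> card {x \<in> box {j..<j+m} A. f x \<noteq> 0}"
  using assms
proof (induction m arbitrary: j t f)
  case 0
  then have "{x \<in> box {j..<j+0} A. f x \<noteq> 0} \<noteq> {}" "finite (box {j..<j+0} A)"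
    using finite_box[of "{j..<j+0}" A] by auto
  then show ?case by (simp add: Suc_le_eq card_gt_0_iff)
next
  case (Suc m)
  let ?I = "{Suc j..<Suc j + m}" and ?c = "\<lambda>i. card (A i)"
  have I: "{j..<j + Suc m} = insert j ?I" "j \<notin> ?I" by auto
  let ?B = "box (insert j ?I) A" and ?B' = "box ?I A"
  have upd: "x(j := a) \<in> ?B" if "x \<in> ?B \<or> x \<in> ?B'" "a \<in> A j" for x a
    using that by (auto simp: box_def)
  have finB': "finite ?B'" using Suc.prems(4) by (intro finite_box) auto
  have f: "poly_fun (insert j ?I) t f" and nz: "\<exists>x\<in>?B. f x \<noteq> 0"
    using Suc.prems(1,2) by (simp_all only: I(1))
  define Z where "Z = {a \<in> A j. \<forall>x\<in>?B'. f (x(j := a)) = 0}"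
  have finA: "finite (A j)" using Suc.prems(4) by simp
  then have finZ: "finite Z" by (simp add: Z_def)
  have "\<exists>g. card Z \<le> t \<and> poly_fun (insert j ?I) (t - card Z) g \<and>
    (\<forall>x\<in>?B. f x = (\<Prod>a\<in>Z. x j - a) * g x)"
  proof (rule poly_fun_factor_out[OF _ finZ])
    show "f x = 0" if "x \<in> ?B" "x j \<in> Z" for x
    proof -
      have "x(j := 0) \<in> ?B'" using that by (auto simp: box_def)
      then show ?thesis using that(2) by (auto simp: Z_def)
    qed
  qed (use f nz upd in \<open>auto simp: Z_def\<close>)
  then obtain g where g: "card Z \<le> t" "poly_fun (insert j ?I) (t - card Z) g"
    "\<And>x. x \<in> ?B \<Longrightarrow> f x = (\<Prod>a\<in>Z. x j - a) * g x" by metis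
  obtain z where z: "z \<in> ?B" "f z \<noteq> 0" using nz by blast
  have "z j \<notin> Z"
  proof
    assume "z j \<in> Z"
    moreover have "z(j := 0) \<in> ?B'" using z(1) by (auto simp: box_def)
    ultimately show False using z(2) by (auto simp: Z_def)
  qed
  moreover have "z j \<in> A j" using z(1) by (simp add: box_def)
  ultimately have cZ: "card Z < card (A j)"
    using finA by (intro psubset_card_mono) (auto simp: Z_def)
  let ?N = "greedy_min (map ?c [Suc j..<Suc j + m]) (t - card Z)"
  have each: "?N \<le> card {x \<in> ?B'. f (x(j := a)) \<noteq> 0}" if a: "a \<in> A j - Z" for a
  proof -
    have prod: "(\<Prod>b\<in>Z. a - b) \<noteq> 0" using a finZ by auto
    have eq: "f (x(j := a)) \<noteq> 0 \<longleftrightarrow> g (x(j := a)) \<noteq> 0" if "x \<in> ?B'" for x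
      using g(3)[of "x(j := a)"] upd[of x a] that a prod by auto
    have "?N \<le> card {x \<in> ?B'. g (x(j := a)) \<noteq> 0}"
    proof (rule Suc.IH)
      show "poly_fun ?I (t - card Z) (\<lambda>x. g (x(j := a)))"
        using poly_fun_fix_var[OF g(2), of j a] by (simp add: I(2))
      show "\<exists>x\<in>?B'. g (x(j := a)) \<noteq> 0" using a eq by (auto simp: Z_def)
      show "sorted (map ?c [Suc j..<Suc j + m])"
        using Suc.prems(3) by (simp add: upt_conv_Cons del: upt_Suc)
    qed (use Suc.prems(4) in auto)
    also have "{x \<in> ?B'. g (x(j := a)) \<noteq> 0} = {x \<in> ?B'. f (x(j := a)) \<noteq> 0}" using eq by auto
    finally show ?thesis .
  qed
  have up: "[j..<j + Suc m] = j # [Suc j..<Suc j + m]" by (simp add: upt_conv_Cons del: upt_Suc)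
  have "greedy_min (map ?c [j..<j + Suc m]) t \<le> (card (A j) - card Z) * ?N"
    unfolding up list.map
    by (rule greedy_min_Cons_le) (use Suc.prems(3)[unfolded up] cZ g(1) in \<open>auto simp del: upt_Suc\<close>)
  also have "\<dots> = (\<Sum>a\<in>A j - Z. ?N)"
    using finZ by (simp add: card_Diff_subset Z_def)
  also have "\<dots> \<le> (\<Sum>a\<in>A j - Z. card {x \<in> ?B'. f (x(j := a)) \<noteq> 0})"
    by (rule sum_mono) (rule each)
  also have "\<dots> = card (SIGMA a:A j - Z. {x \<in> ?B'. f (x(j := a)) \<noteq> 0})"
    using finA finB' by (subst card_SigmaI) auto
  also have "\<dots> = card ((\<lambda>(a, x). x(j := a)) ` (SIGMA a:A j - Z. {x \<in> ?B'. f (x(j := a)) \<noteq> 0}))"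
    by (rule card_image[symmetric]) (rule inj_on_subset[OF inj_on_box_update[OF I(2), of A]], auto)
  also have "\<dots> \<le> card {x \<in> ?B. f x \<noteq> 0}"
  proof (rule card_mono)
    have "finite ?B" using finA finB' by (subst box_insert[OF I(2)]) blast
    then show "finite {x \<in> ?B. f x \<noteq> 0}" by simp
  qed (use upd in auto)
  finally show ?case by (simp only: I(1))
qed

section \<open>Forms on a vector space over one field\<close>

lemma is_subfieldD:
  assumes "is_subfield F"
  shows "0 \<in> F" "1 \<in> F" "x \<in> F \<Longrightarrow> y \<in> F \<Longrightarrow> x + y \<in> F" "x \<in> F \<Longrightarrow> y \<in> F \<Longrightarrow> x * y \<in> F"
    "x \<in> F \<Longrightarrow> - x \<in> F" "x \<in> F \<Longrightarrow> inverse x \<in> F" "x \<in> F \<Longrightarrow> y \<in> F \<Longrightarrow> x - y \<in> F"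
    "x \<in> F \<Longrightarrow> y \<in> F \<Longrightarrow> x / y \<in> F"
proof -
  have neg: "- x \<in> F" if "x \<in> F" for x using assms that by (simp add: is_subfield_def)
  have sum: "x + y \<in> F" if "x \<in> F" "y \<in> F" for x y using assms that by (simp add: is_subfield_def)
  show "x \<in> F \<Longrightarrow> y \<in> F \<Longrightarrow> x - y \<in> F" using sum[OF _ neg] by simp
qed (use assms in \<open>auto simp: is_subfield_def divide_inverse\<close>)

lemma is_subfield_sum:
  assumes "is_subfield F" "\<And>i. i \<in> S \<Longrightarrow> f i \<in> F"
  shows "sum f S \<in> F"
  using assms(2) by (induction S rule: infinite_finite_induct) (auto simp: is_subfieldD[OF assms(1)])

lemma card_subfield_ge_2:
  assumes "is_subfield (F :: 'a::field set)" "finite F"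
  shows "2 \<le> card F"
proof -
  have "card {0, 1 :: 'a} \<le> card F"
    using assms is_subfieldD(1,2)[OF assms(1)] by (intro card_mono) auto
  then show ?thesis by simp
qed

lemma sum_card_swap:
  assumes "finite A" "finite B"
  shows "(\<Sum>a\<in>A. card {b \<in> B. P a b}) = (\<Sum>b\<in>B. card {a \<in> A. P a b})"
proof -
  have eq: "card {x \<in> S. Q x} = (\<Sum>x\<in>S. if Q x then 1 else 0)" if "finite S" for S :: "'c set" and Q
    using that by (simp add: sum.If_cases Int_def)
  show ?thesis unfolding eq[OF assms(1)] eq[OF assms(2)] by (rule sum.swap)
qed

definition lin_comb :: "nat \<Rightarrow> (nat \<Rightarrow> nat \<Rightarrow> 'a::field) \<Rightarrow> (nat \<Rightarrow> 'a) \<Rightarrow> nat \<Rightarrow> 'a" where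
  "lin_comb u w y = (\<lambda>j. \<Sum>i<u. y i * w i j)"

text \<open>Let \<open>R\<close> be a maximal subspace of zeros, of dimension \<open>u\<close>.
  Averaging the affine bound over all cosets outside \<open>R\<close> gives
  \<open>q ^ (r + 1 - u) - 1\<close> times the greedy value for \<open>u\<close> variables, and this
  exceeds the stated bound whatever \<open>u\<close> is or equals it.\<close>

lemma projective_nonzeros:
  fixes F :: "'a::field set" and r :: nat
  defines "V \<equiv> box {..r} (\<lambda>_. F)"
  assumes F: "is_subfield F" "finite F" and g: "poly_fun {..r} d g" and d: "1 \<le> d"
    and hom: "\<And>c x. c \<in> F \<Longrightarrow> x \<in> V \<Longrightarrow> g (\<lambda>i. c * x i) = c ^ d * g x"
    and nz: "\<exists>x\<in>V. g x \<noteq> 0"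
  shows "(card F - 1) * greedy_min (replicate r (card F)) (d - 1) \<le> card {x \<in> V. g x \<noteq> 0}"
proof -
  define q where "q = card F"
  have q: "2 \<le> q" using card_subfield_ge_2 F by (simp add: q_def)
  note sf = is_subfieldD[OF F(1)]
  define Y where "Y u = box {0..<u} (\<lambda>_. F)" for u :: nat
  have finY: "finite (Y u)" for u using F by (simp add: Y_def finite_box)
  have cardY: "card (Y u) = q ^ u" for u by (simp add: Y_def card_box q_def)
  have finV: "finite V" using F by (simp add: V_def finite_box)
  have cardV: "card V = q ^ (r + 1)" by (simp add: V_def card_box q_def)
  have Vscale: "(\<lambda>i. c * x i) \<in> V" if "c \<in> F" "x \<in> V" for c x
    using that sf by (auto simp: V_def box_def)
  have Vadd: "(\<lambda>i. x i + y i) \<in> V" if "x \<in> V" "y \<in> V" for x y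
    using that sf by (auto simp: V_def box_def)
  have Vlin: "lin_comb u w y \<in> V" if "\<forall>i<u. w i \<in> V" "y \<in> Y u" for u w y
    using that sf by (auto simp: V_def Y_def box_def lin_comb_def intro!: is_subfield_sum[OF F(1)])
  \<comment> \<open>\<open>w\<close> lists a basis of a \<open>u\<close>-dimensional subspace on which \<open>g\<close> vanishes\<close>
  define good where "good u w \<longleftrightarrow> (\<forall>i<u. w i \<in> V) \<and> inj_on (lin_comb u w) (Y u) \<and>
    (\<forall>y\<in>Y u. g (lin_comb u w y) = 0)" for u w
  obtain z where z: "z \<in> V" "g z \<noteq> 0" using nz by blast
  have Y0: "Y 0 = {\<lambda>_. 0}" by (auto simp: Y_def box_def)
  have "g (\<lambda>_. 0) = 0" using hom[of 0 z] z sf d by simp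
  then have good0: "good 0 (\<lambda>_ _. 0)" by (simp add: good_def Y0 lin_comb_def)
  \<comment> \<open>The span misses the point \<open>z\<close> at which \<open>g\<close> is nonzero,
    so it is a proper subset of \<open>V\<close>.\<close>
  have good_le: "u \<le> r" if "good u w" for u w
  proof -
    have "lin_comb u w ` Y u \<subseteq> V - {z}" using that Vlin z by (auto simp: good_def)
    then have "lin_comb u w ` Y u \<subset> V" using z by auto
    then have "card (lin_comb u w ` Y u) < card V" using finV by (rule psubset_card_mono[rotated])
    moreover have "card (lin_comb u w ` Y u) = card (Y u)"
      using that by (intro card_image) (simp add: good_def)
    ultimately have "q ^ u < q ^ (r + 1)" by (simp only: cardV cardY)
    then show ?thesis using q by (subst (asm) power_strict_increasing_iff) auto
  qed
  define u where "u = (GREATEST u. \<exists>w. good u w)"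
  have "\<exists>w. good u w"
    unfolding u_def
  proof (rule GreatestI_ex_nat[where b = r])
    show "\<exists>u w. good u w" using good0 by blast
  qed (use good_le in blast)
  then obtain w where uw: "good u w" by blast
  have max: "\<not> good (Suc u) w'" for w'
  proof
    assume "good (Suc u) w'"
    then have "\<exists>w. good (Suc u) w" by blast
    then have "Suc u \<le> u"
      unfolding u_def[symmetric] by (subst (2) u_def, rule Greatest_le_nat[where b = r]) (use good_le in blast)
    then show False by simp
  qed
  let ?L = "lin_comb u w"
  define R where "R = ?L ` Y u"
  have RV: "R \<subseteq> V" using Vlin uw by (auto simp: R_def good_def)
  have cardR: "card R = q ^ u" using uw by (simp add: R_def good_def card_image cardY)
  let ?A = "\<lambda>u. greedy_min (replicate u q) (d - 1)"
  have each: "?A u \<le> card {y \<in> Y u. g (\<lambda>j. ?L y j + v j) \<noteq> 0}" if v: "v \<in> V - R" for v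
  proof -
    define w' where "w' = w(u := v)"
    let ?L' = "lin_comb (Suc u) w'"
    have L': "?L' y = (\<lambda>j. ?L y j + y u * v j)" for y
      by (simp add: lin_comb_def w'_def fun_eq_iff)
    have L_cong: "?L (y(u := c)) = ?L y" for y c by (simp add: lin_comb_def)
    have Y_cut: "y(u := 0) \<in> Y u" if "y \<in> Y (Suc u)" for y
      using that by (auto simp: Y_def box_def)
    have w'V: "\<forall>i<Suc u. w' i \<in> V" using uw v by (auto simp: w'_def good_def less_Suc_eq)
    \<comment> \<open>A vector \<open>v\<close> outside \<open>R\<close> is independent of the
      \<open>w i\<close>: two equal combinations with different coefficients at \<open>v\<close>
      would express \<open>v\<close> by the \<open>w i\<close>. By maximality \<open>g\<close> is
      then nonzero somewhere on the enlarged span.\<close>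
    have "inj_on ?L' (Y (Suc u))"
    proof (rule inj_onI)
      fix y y' assume y: "y \<in> Y (Suc u)" "y' \<in> Y (Suc u)" and eq: "?L' y = ?L' y'"
      show "y = y'"
      proof (cases "y u = y' u")
        case True
        then have "?L (y(u := 0)) = ?L (y'(u := 0))"
          using eq by (simp add: L_cong) (simp add: L' fun_eq_iff)
        then have "y(u := 0) = y'(u := 0)"
          using uw Y_cut y by (auto simp: good_def inj_on_def)
        then show ?thesis using True by (metis fun_upd_triv fun_upd_upd)
      next
        case False
        define c where "c = inverse (y u - y' u)"
        define s where "s = (\<lambda>i. if i < u then c * (y' i - y i) else 0)"
        have "v j = ?L s j" for j
        proof -
          have "?L s j = (\<Sum>i<u. c * (y' i * w i j - y i * w i j))"
            unfolding lin_comb_def s_def by (intro sum.cong) (auto simp: algebra_simps)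
          also have "\<dots> = c * (?L y' j - ?L y j)"
            by (simp add: lin_comb_def sum_distrib_left[symmetric] sum_subtractf)
          also have "?L y' j - ?L y j = (y u - y' u) * v j"
            using fun_cong[OF eq, of j] by (simp add: L' algebra_simps)
          finally show ?thesis using False by (simp add: c_def)
        qed
        moreover have "s \<in> Y u"
          using y sf by (auto simp: Y_def box_def s_def c_def)
        ultimately have "v \<in> R" unfolding R_def by (metis (no_types) ext imageI)
        then show ?thesis using v by simp
      qed
    qed
    then obtain y where y: "y \<in> Y (Suc u)" "g (?L' y) \<noteq> 0"
      using max[of w'] w'V by (auto simp: good_def)
    have gcut: "g (?L (x(u := 0))) = 0" if "x \<in> Y (Suc u)" for x
      using uw Y_cut[OF that] by (simp add: good_def)
    \<comment> \<open>In coordinates of the enlarged span, \<open>g\<close> vanishes where the last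
      coordinate is 0. Dividing by that coordinate lowers the degree to \<open>d - 1\<close>, and
      setting it to 1 recovers \<open>g\<close> on the coset of \<open>v\<close>.\<close>
    have "poly_fun {0..<Suc u} d (\<lambda>x. g (?L' x))"
      unfolding lin_comb_def
      by (rule poly_fun_subst[OF g]) (intro poly_fun_sum poly_fun_linear, auto)
    then obtain h where h: "poly_fun {0..<Suc u} (d - 1) h"
      "\<And>x. g (?L' x) = g (?L' (x(u := 0))) + x u * h x"
      using poly_fun_divide[of "{0..<Suc u}" d _ u 0] d by (metis diff_zero not_one_le_zero)
    have h1: "g (\<lambda>j. ?L x j + v j) = h (x(u := 1))" if "x \<in> Y u" for x
    proof -
      have "x(u := 1) \<in> Y (Suc u)" using that sf by (auto simp: Y_def box_def)
      then have "g (?L' ((x(u := 1))(u := 0))) = 0" using gcut[of "x(u := 1)"] by (simp add: L' L_cong)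
      then show ?thesis using h(2)[of "x(u := 1)"] by (simp add: L' L_cong)
    qed
    have yu: "y u \<noteq> 0"
    proof
      assume "y u = 0"
      then have "?L' y = ?L (y(u := 0))" by (simp add: L' L_cong)
      then show False using gcut y by simp
    qed
    have yF: "y i \<in> F" for i using y sf by (cases "i < Suc u") (auto simp: Y_def box_def)
    \<comment> \<open>Homogeneity allows scaling the nonzero \<open>y\<close> to last coordinate 1,
      which puts it on the coset of \<open>v\<close>; the entry at \<open>u\<close> is reset to 0
      because \<open>v\<close> is now added separately.\<close>
    define x where "x = (\<lambda>i. y i / y u)(u := 0)"
    have xY: "x \<in> Y u" using y yF sf by (auto simp: Y_def box_def x_def)
    have "?L' y = (\<lambda>j. y u * (?L x j + v j))"
    proof
      fix j
      have "?L x j = (\<Sum>i<u. y i * w i j / y u)"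
        unfolding lin_comb_def x_def by (intro sum.cong) auto
      also have "\<dots> = ?L y j / y u" by (simp add: lin_comb_def sum_divide_distrib)
      finally show "?L' y j = y u * (?L x j + v j)" using yu by (simp add: L' distrib_left)
    qed
    moreover have "(\<lambda>j. ?L x j + v j) \<in> V"
      using Vadd Vlin xY uw v by (auto simp: good_def)
    ultimately have "g (\<lambda>j. ?L x j + v j) \<noteq> 0" using hom[OF yF[of u]] y(2) by auto
    then have ex: "\<exists>x\<in>Y u. h (x(u := 1)) \<noteq> 0" using h1 xY by auto
    have "{0..<Suc u} - {u} = {0..<0 + u}" by auto
    then have "poly_fun {0..<0 + u} (d - 1) (\<lambda>x. h (x(u := 1)))"
      using poly_fun_fix_var[OF h(1), of u 1] by simp
    from affine_nonzeros[OF this, of "\<lambda>_. F"] ex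
    have "?A u \<le> card {x \<in> Y u. h (x(u := 1)) \<noteq> 0}"
      using F by (simp add: Y_def map_replicate_const q_def)
    also have "{x \<in> Y u. h (x(u := 1)) \<noteq> 0} = {y \<in> Y u. g (\<lambda>j. ?L y j + v j) \<noteq> 0}"
      using h1 by auto
    finally show ?thesis .
  qed
  let ?N = "card {x \<in> V. g x \<noteq> 0}"
  have ur: "u \<le> r" using good_le uw by blast
  \<comment> \<open>Double counting of pairs \<open>(v, y)\<close>: for fixed \<open>y\<close> the
    translation by \<open>?L y\<close> is injective, so each of the \<open>q ^ u\<close> choices of
    \<open>y\<close> accounts for at most \<open>?N\<close> pairs.\<close>
  have "(q ^ (r + 1) - q ^ u) * ?A u = (\<Sum>v\<in>V - R. ?A u)"
    using RV finV by (simp add: card_Diff_subset finite_subset cardV cardR)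
  also have "\<dots> \<le> (\<Sum>v\<in>V - R. card {y \<in> Y u. g (\<lambda>j. ?L y j + v j) \<noteq> 0})"
    by (rule sum_mono) (rule each)
  also have "\<dots> = (\<Sum>y\<in>Y u. card {v \<in> V - R. g (\<lambda>j. ?L y j + v j) \<noteq> 0})"
    by (rule sum_card_swap) (use finV finY in auto)
  also have "\<dots> \<le> (\<Sum>y\<in>Y u. ?N)"
  proof (rule sum_mono)
    fix y assume y: "y \<in> Y u"
    show "card {v \<in> V - R. g (\<lambda>j. ?L y j + v j) \<noteq> 0} \<le> ?N"
    proof (rule card_inj_on_le)
      show "inj_on (\<lambda>v j. ?L y j + v j) {v \<in> V - R. g (\<lambda>j. ?L y j + v j) \<noteq> 0}"
        by (rule inj_onI) (auto simp: fun_eq_iff)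
    qed (use Vadd Vlin y uw finV in \<open>auto simp: good_def\<close>)
  qed
  also have "\<dots> = q ^ u * ?N" by (simp add: cardY)
  finally have "q ^ u * ((q ^ (r + 1 - u) - 1) * ?A u) \<le> q ^ u * ?N"
    using ur by (simp add: diff_mult_distrib2 mult.assoc[symmetric] power_add[symmetric])
  then have N: "(q ^ (r + 1 - u) - 1) * ?A u \<le> ?N" using q by simp
  \<comment> \<open>One admissible distribution leaves \<open>r - u\<close> of the sizes untouched,
    whence \<open>e = 0\<close> in \<open>greedy_min_append_le\<close>.\<close>
  have "?A r \<le> ?A u * q ^ (r - u)"
    using greedy_min_append_le[of "replicate u q" "replicate (r - u) q" 0 "d - 1"] q ur
      greedy_min_0[of "replicate (r - u) q"]
    by (simp add: replicate_add[symmetric] sorted_append)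
  then have "(q - 1) * ?A r \<le> (q - 1) * q ^ (r - u) * ?A u"
    by (metis mult.assoc mult.commute mult_le_mono2)
  also have "\<dots> \<le> (q ^ (r + 1 - u) - 1) * ?A u"
    using q ur by (intro mult_right_mono) (auto simp: diff_mult_distrib Suc_diff_le intro!: diff_le_mono2)
  finally show ?thesis using N by (simp add: q_def)
qed

section \<open>Forms over two field sizes\<close>

definition monom_eval :: "(nat \<Rightarrow>\<^sub>0 nat) \<Rightarrow> (nat \<Rightarrow> 'a::field) \<Rightarrow> 'a" where
  "monom_eval m x = (\<Prod>i\<in>Poly_Mapping.keys m. x i ^ Poly_Mapping.lookup m i)"

lemma poly_eval_monom_eval: "poly_eval f x = (\<Sum>m\<in>Poly_Mapping.keys f. Poly_Mapping.lookup f m * monom_eval m x)"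
  by (simp add: poly_eval_def monom_eval_def)

lemma poly_fun_prod_power:
  "finite S \<Longrightarrow> S \<subseteq> I \<Longrightarrow> poly_fun I (\<Sum>i\<in>S. e i) (\<lambda>x. \<Prod>i\<in>S. x i ^ e i)"
proof (induction S rule: finite_induct)
  case (insert j S)
  have "poly_fun I k (\<lambda>x. x j ^ k)" for k
    using insert.prems by (induction k) (auto intro: poly_fun.intros)
  from poly_fun_mult[OF this insert.IH] insert show ?case by simp
qed (simp add: poly_fun.const)

lemma prod_power_scale:
  fixes c :: "'a::comm_semiring_1"
  shows "(\<Prod>i\<in>S. (c * x i) ^ e i) = c ^ (\<Sum>i\<in>S. e i) * (\<Prod>i\<in>S. x i ^ e i)"
  by (simp add: power_mult_distrib prod.distrib power_sum)

lemma poly_eval_scale: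
  assumes "f \<in> homogeneous_polys n d"
  shows "poly_eval f (\<lambda>i. c * x i) = c ^ d * poly_eval f x"
  unfolding poly_eval_monom_eval sum_distrib_left
  by (rule sum.cong) (use assms in \<open>auto simp: monom_eval_def prod_power_scale homogeneous_polys_def\<close>)

lemma poly_fun_poly_eval:
  assumes "f \<in> homogeneous_polys n d"
  shows "poly_fun {..n} d (poly_eval f)"
proof -
  have "poly_fun {..n} d (monom_eval m)" if "m \<in> Poly_Mapping.keys f" for m
    using poly_fun_prod_power[of "Poly_Mapping.keys m" "{..n}" "Poly_Mapping.lookup m"] assms that
    by (simp add: monom_eval_def[abs_def] homogeneous_polys_def)
  then have "poly_fun {..n} d (\<lambda>x. \<Sum>m\<in>Poly_Mapping.keys f. Poly_Mapping.lookup f m * monom_eval m x)"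
    by (intro poly_fun_sum poly_fun_cmult)
  then show ?thesis by (simp add: poly_eval_monom_eval[abs_def])
qed

definition merge :: "nat \<Rightarrow> (nat \<Rightarrow> 'a) \<Rightarrow> (nat \<Rightarrow> 'a) \<Rightarrow> nat \<Rightarrow> 'a" where
  "merge r x y = (\<lambda>i. if i \<le> r then x i else y i)"

text \<open>Monomials are grouped by their degree \<open>hi\<close> in the variables beyond
  \<open>r\<close>; homogeneity of \<open>f\<close> then fixes their degree \<open>lo\<close> in the
  others. \<open>P e\<close> is the component of bidegree \<open>(d - e, e)\<close>.\<close>

lemma homogeneous_bigraded:
  assumes f: "(f :: 'a::field mpoly) \<in> homogeneous_polys n d"
  obtains P where
    "\<And>e y. e \<le> d \<Longrightarrow> poly_fun {..r} (d - e) (\<lambda>x. P e x y)"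
    "\<And>e c x y. e \<le> d \<Longrightarrow> P e (\<lambda>i. c * x i) y = c ^ (d - e) * P e x y"
    "\<And>e x. e \<le> d \<Longrightarrow> poly_fun {Suc r..n} e (P e x)"
    "\<And>e c x y. e \<le> d \<Longrightarrow> P e x (\<lambda>i. c * y i) = c ^ e * P e x y"
    "\<And>x y. poly_eval f (merge r x y) = (\<Sum>e\<le>d. P e x y)"
proof
  define lo hi where "lo m = (\<Sum>i\<in>Poly_Mapping.keys m \<inter> {..r}. Poly_Mapping.lookup m i)"
    and "hi m = (\<Sum>i\<in>Poly_Mapping.keys m \<inter> {r<..}. Poly_Mapping.lookup m i)" for m :: "nat \<Rightarrow>\<^sub>0 nat"
  define mlo mhi where "mlo m x = (\<Prod>i\<in>Poly_Mapping.keys m \<inter> {..r}. x i ^ Poly_Mapping.lookup m i)"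
    and "mhi m x = (\<Prod>i\<in>Poly_Mapping.keys m \<inter> {r<..}. x i ^ Poly_Mapping.lookup m i)" for m :: "nat \<Rightarrow>\<^sub>0 nat" and x :: "nat \<Rightarrow> 'a"
  define P where "P e x y = (\<Sum>m | m \<in> Poly_Mapping.keys f \<and> hi m = e. Poly_Mapping.lookup f m * (mlo m x * mhi m y))" for e x y
  have split: "Poly_Mapping.keys m = Poly_Mapping.keys m \<inter> {..r} \<union> Poly_Mapping.keys m \<inter> {r<..}" for m :: "nat \<Rightarrow>\<^sub>0 nat" by auto
  have deg: "lo m + hi m = d" if "m \<in> Poly_Mapping.keys f" for m
  proof -
    have "lo m + hi m = (\<Sum>i\<in>Poly_Mapping.keys m. Poly_Mapping.lookup m i)"
      unfolding lo_def hi_def by (subst (3) split, rule sum.union_disjoint[symmetric]) auto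
    then show ?thesis using f that by (simp add: homogeneous_polys_def)
  qed
  have vars: "Poly_Mapping.keys m \<subseteq> {..n}" if "m \<in> Poly_Mapping.keys f" for m using f that by (simp add: homogeneous_polys_def)
  have lo: "lo m = d - e" if "m \<in> Poly_Mapping.keys f" "hi m = e" for m e using deg[OF that(1)] that(2) by simp
  have plo: "poly_fun {..r} (lo m) (mlo m)" for m
    unfolding lo_def mlo_def by (rule poly_fun_prod_power) auto
  have phi: "poly_fun {Suc r..n} (hi m) (mhi m)" if "m \<in> Poly_Mapping.keys f" for m
    unfolding hi_def mhi_def by (rule poly_fun_prod_power) (use vars[OF that] in auto)
  show "poly_fun {..r} (d - e) (\<lambda>x. P e x y)" for e y
    unfolding P_def
  proof (rule poly_fun_sum)
    fix m assume "m \<in> {m \<in> Poly_Mapping.keys f. hi m = e}"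
    then have "poly_fun {..r} (d - e) (\<lambda>x. (Poly_Mapping.lookup f m * mhi m y) * mlo m x)"
      using plo[of m] lo by (intro poly_fun_cmult) auto
    then show "poly_fun {..r} (d - e) (\<lambda>x. Poly_Mapping.lookup f m * (mlo m x * mhi m y))" by (simp add: mult_ac)
  qed
  show "poly_fun {Suc r..n} e (P e x)" for e x
    unfolding P_def[abs_def]
  proof (rule poly_fun_sum)
    fix m assume "m \<in> {m \<in> Poly_Mapping.keys f. hi m = e}"
    then have "poly_fun {Suc r..n} e (\<lambda>y. (Poly_Mapping.lookup f m * mlo m x) * mhi m y)"
      using phi[of m] by (intro poly_fun_cmult) auto
    then show "poly_fun {Suc r..n} e (\<lambda>y. Poly_Mapping.lookup f m * (mlo m x * mhi m y))" by (simp add: mult_ac)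
  qed
  show "P e (\<lambda>i. c * x i) y = c ^ (d - e) * P e x y" for e c x y
    unfolding P_def sum_distrib_left
    by (rule sum.cong) (auto simp: mlo_def prod_power_scale lo_def[symmetric] lo)
  show "P e x (\<lambda>i. c * y i) = c ^ e * P e x y" for e c x y
    unfolding P_def sum_distrib_left
    by (rule sum.cong) (auto simp: mhi_def prod_power_scale hi_def[symmetric])
  show "poly_eval f (merge r x y) = (\<Sum>e\<le>d. P e x y)" for x y
  proof -
    have "monom_eval m (merge r x y) = mlo m x * mhi m y" for m
    proof -
      have "monom_eval m (merge r x y) = (\<Prod>i\<in>Poly_Mapping.keys m \<inter> {..r}. merge r x y i ^ Poly_Mapping.lookup m i)
          * (\<Prod>i\<in>Poly_Mapping.keys m \<inter> {r<..}. merge r x y i ^ Poly_Mapping.lookup m i)"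
        unfolding monom_eval_def by (subst split, rule prod.union_disjoint) auto
      then show ?thesis by (simp add: mlo_def mhi_def merge_def)
    qed
    moreover have "(\<Sum>m\<in>Poly_Mapping.keys f. Poly_Mapping.lookup f m * (mlo m x * mhi m y)) = (\<Sum>e\<le>d. P e x y)"
      unfolding P_def by (rule sum.group[symmetric]) (use deg in \<open>force+\<close>)
    ultimately show ?thesis by (simp add: poly_eval_monom_eval)
  qed
qed

lemma polynomial_vanishing_imp_lead_0:
  fixes c :: "nat \<Rightarrow> 'a::field"
  assumes "\<And>s. s \<in> S \<Longrightarrow> (\<Sum>i\<le>e. c i * s ^ i) = 0" "e < card S"
  shows "c e = 0"
proof (rule ccontr)
  assume ce: "c e \<noteq> 0"
  define p where "p = (\<Sum>i\<le>e. monom (c i) i)"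
  have "coeff p e = c e" by (simp add: p_def coeff_sum)
  then have p: "p \<noteq> 0" using ce by auto
  have "S \<subseteq> {s. poly p s = 0}" using assms(1) by (auto simp: p_def poly_sum poly_monom)
  then have "card S \<le> card {s. poly p s = 0}" using p by (intro card_mono poly_roots_finite)
  also have "\<dots> \<le> degree p" by (rule card_poly_roots_bound[OF p])
  also have "\<dots> \<le> e" unfolding p_def
    by (rule degree_sum_le) (auto intro: order_trans[OF degree_monom_le])
  finally show False using assms(2) by simp
qed

text \<open>The bound is the number of \<open>x\<close> with \<open>P e x y0\<close> nonzero times a
  count of \<open>y\<close> for each such \<open>x\<close>, with \<open>e\<close> the top degree
  that survives. Only nonzero \<open>x\<close> are counted, so that the first nonzero coordinate of
  the merged vector lies in \<open>F\<close>.\<close>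

lemma nested_nonzeros:
  fixes F :: "'a::field set" and K :: "nat \<Rightarrow> 'a set" and n r d :: nat
  defines "V \<equiv> box {..r} (\<lambda>_. F)" and "T \<equiv> box {Suc r..n} K"
    and "D \<equiv> card (K (Suc r))"
  assumes F: "is_subfield F" "finite F" and r: "1 \<le> r" "r < n"
    and K: "\<And>i. i \<in> {Suc r..n} \<Longrightarrow> is_subfield (K i) \<and> finite (K i) \<and> K (Suc r) \<subseteq> K i"
    and sorted: "sorted (map (\<lambda>i. card (K i)) [Suc r..<Suc n])"
    and D: "(card F)\<^sup>2 \<le> D" and d: "1 \<le> d" "d < D"
    and f: "f \<in> homogeneous_polys n d"
    and nz: "\<exists>x\<in>V. \<exists>y\<in>T. poly_eval f (merge r x y) \<noteq> 0"
  shows "(card F - 1) * greedy_min (replicate r (card F) @ map (\<lambda>i. card (K i)) [Suc r..<Suc n]) (d - 1)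
    \<le> card {(x, y) \<in> (V - {\<lambda>_. 0}) \<times> T. poly_eval f (merge r x y) \<noteq> 0}"
proof -
  obtain P where P: "\<And>e y. e \<le> d \<Longrightarrow> poly_fun {..r} (d - e) (\<lambda>x. P e x y)"
    "\<And>e c x y. e \<le> d \<Longrightarrow> P e (\<lambda>i. c * x i) y = c ^ (d - e) * P e x y"
    "\<And>e x. e \<le> d \<Longrightarrow> poly_fun {Suc r..n} e (P e x)"
    "\<And>e c x y. e \<le> d \<Longrightarrow> P e x (\<lambda>i. c * y i) = c ^ e * P e x y"
    "\<And>x y. poly_eval f (merge r x y) = (\<Sum>e\<le>d. P e x y)"
  proof (rule homogeneous_bigraded[OF f, of r], goal_cases)
    case (1 P)
    show ?case by (rule 1(1)) (fact 1)+
  qed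
  let ?q = "card F" and ?V = "V - {\<lambda>_. 0}"
  define zs where "zs = map (\<lambda>i. card (K i)) [Suc (Suc r)..<Suc n]"
  have up: "map (\<lambda>i. card (K i)) [Suc r..<Suc n] = D # zs"
    using r by (simp add: upt_conv_Cons zs_def D_def del: upt_Suc)
  have q: "2 \<le> ?q" using card_subfield_ge_2 F by blast
  have qD: "?q \<le> D" using D q by (metis power2_nat_le_imp_le)
  have srt: "sorted (D # zs)" using sorted up by simp
  have zpos: "\<forall>z\<in>set zs. 0 < z" using srt d by fastforce
  have finV: "finite V" using F by (simp add: V_def finite_box)
  have finT: "finite T" unfolding T_def by (rule finite_box) (use K in auto)
  have P0: "P e (\<lambda>_. 0) y = 0 ^ (d - e) * P e x y" if "e \<le> d" for e x y
    using P(2)[OF that, of 0 x y] by simp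
  define E where "E = {e. e \<le> d \<and> (\<exists>x\<in>?V. \<exists>y\<in>T. P e x y \<noteq> 0)}"
  have finE: "finite E" by (rule finite_subset[of _ "{..d}"]) (auto simp: E_def)
  have "(\<lambda>i. if i \<le> r then 1 else 0) \<in> ?V" using is_subfieldD[OF F(1)]
    by (auto simp: V_def box_def fun_eq_iff)
  then obtain v where v: "v \<in> ?V" by blast
  have "E \<noteq> {}"
  proof
    assume E: "E = {}"
    obtain x y where xy: "x \<in> V" "y \<in> T" "poly_eval f (merge r x y) \<noteq> 0" using nz by blast
    have zero: "P e x' y = 0" if "e \<le> d" "x' \<in> ?V" for e x' using E that xy by (auto simp: E_def)
    \<comment> \<open>At \<open>x = 0\<close> the components with \<open>e < d\<close> vanish, and
      the one with \<open>e = d\<close> has the same value as at the nonzero vector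
      \<open>v\<close>.\<close>
    have "P e x y = 0" if "e \<le> d" for e
      using zero[OF that v] zero[OF that, of x] P0[OF that, of y v] xy by (cases "x = (\<lambda>_. 0)") auto
    then show False using xy(3) P(5) by simp
  qed
  define e where "e = Max E"
  have "e \<in> E" using \<open>E \<noteq> {}\<close> finE by (simp add: e_def)
  then obtain x0 y0 where e: "e \<le> d" "x0 \<in> ?V" "y0 \<in> T" "P e x0 y0 \<noteq> 0" by (auto simp: E_def)
  have big: "P e' x y = 0" if "e < e'" "e' \<le> d" "x \<in> ?V" "y \<in> T" for e' x y
  proof (rule ccontr)
    assume "P e' x y \<noteq> 0"
    then have "e' \<in> E" using that unfolding E_def by blast
    then have "e' \<le> e" unfolding e_def by (rule Max_ge[OF finE])
    then show False using that(1) by simp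
  qed
  have eval: "poly_eval f (merge r x y) = (\<Sum>e'\<le>e. P e' x y)" if "x \<in> ?V" "y \<in> T" for x y
    unfolding P(5) by (rule sum.mono_neutral_right) (use e big that in auto)
  define S where "S = {x \<in> ?V. P e x y0 \<noteq> 0}"
  have finS: "finite S" using finV by (simp add: S_def)
  have each: "(D - e) * prod_list zs \<le> card {y \<in> T. poly_eval f (merge r x y) \<noteq> 0}" if x: "x \<in> S" for x
  proof -
    have xV: "x \<in> ?V" using x by (simp add: S_def)
    have ex: "\<exists>y\<in>T. (\<Sum>e'\<le>e. P e' x y) \<noteq> 0"
    proof (rule ccontr)
      assume H: "\<not> ?thesis"
      \<comment> \<open>Along the multiples \<open>s * y0\<close> with \<open>s\<close> in
        \<open>K (Suc r)\<close>, which remain in \<open>T\<close>, the sum is a polynomial in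
        \<open>s\<close> with coefficient \<open>P e x y0\<close> at degree \<open>e\<close>. It has
        \<open>D > e\<close> roots.\<close>
      have "P e x y0 = 0"
      proof (rule polynomial_vanishing_imp_lead_0)
        fix s assume s: "s \<in> K (Suc r)"
        have "s * y0 i \<in> K i" if "i \<in> {Suc r..n}" for i
          using is_subfieldD(4)[of "K i" s "y0 i"] K[OF that] s e(3) that by (auto simp: T_def box_def)
        then have "(\<lambda>i. s * y0 i) \<in> T" using e(3) by (auto simp: T_def box_def)
        then have "(\<Sum>e'\<le>e. P e' x (\<lambda>i. s * y0 i)) = 0" using H by blast
        moreover have "(\<Sum>e'\<le>e. P e' x (\<lambda>i. s * y0 i)) = (\<Sum>e'\<le>e. P e' x y0 * s ^ e')"
          by (rule sum.cong) (use P(4) e(1) in \<open>auto simp: mult.commute\<close>)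
        ultimately show "(\<Sum>e'\<le>e. P e' x y0 * s ^ e') = 0" by simp
      qed (use e(1) d in \<open>simp add: D_def[symmetric]\<close>)
      then show False using x by (simp add: S_def)
    qed
    have I: "{Suc r..<Suc n} = {Suc r..n}" "Suc r + (n - r) = Suc n" using r by auto
    have "poly_fun {Suc r..n} e (\<lambda>y. \<Sum>e'\<le>e. P e' x y)"
      by (rule poly_fun_sum, rule poly_fun_mono[OF P(3)]) (use e(1) in auto)
    then have "greedy_min (map (\<lambda>i. card (K i)) [Suc r..<Suc r + (n - r)]) e
        \<le> card {y \<in> box {Suc r..<Suc r + (n - r)} K. (\<Sum>e'\<le>e. P e' x y) \<noteq> 0}"
      by (intro affine_nonzeros; unfold I) (use ex sorted K T_def in \<open>auto simp del: upt_Suc\<close>)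
    then have "greedy_min (D # zs) e \<le> card {y \<in> T. (\<Sum>e'\<le>e. P e' x y) \<noteq> 0}"
      unfolding I up T_def .
    moreover have "greedy_min (D # zs) e = (D - e) * prod_list zs"
      by (rule greedy_min_Cons_less) (use e d zpos in auto)
    moreover have "{y \<in> T. (\<Sum>e'\<le>e. P e' x y) \<noteq> 0} = {y \<in> T. poly_eval f (merge r x y) \<noteq> 0}"
      using eval[OF xV] by auto
    ultimately show ?thesis by simp
  qed
  have main: "(?q - 1) * greedy_min (replicate r ?q @ D # zs) (d - 1) \<le> card S * ((D - e) * prod_list zs)"
  proof (cases "e = d")
    case True
    \<comment> \<open>For \<open>e = d\<close> scaling \<open>x\<close> by 0 multiplies by
      \<open>0 ^ 0 = 1\<close>, so \<open>P e\<close> does not depend on \<open>x\<close> and every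
      nonzero vector lies in \<open>S\<close>.\<close>
    have "P e x y0 \<noteq> 0" for x
      using P0[OF e(1), of y0 x] P0[OF e(1), of y0 x0] True e(4) by simp
    then have "S = ?V" by (auto simp: S_def)
    moreover have "(\<lambda>_. 0) \<in> V" using is_subfieldD[OF F(1)] by (simp add: V_def box_def)
    ultimately have "card S = ?q ^ (r + 1) - 1" by (simp add: V_def card_box)
    then show ?thesis using greedy_min_replicate_append_bound[OF q D r(1) d srt] True by simp
  next
    case False
    have "(?q - 1) * greedy_min (replicate r ?q) (d - e - 1) \<le> card {x \<in> V. P e x y0 \<noteq> 0}"
      unfolding V_def
      by (rule projective_nonzeros[OF F P(1)[OF e(1)]]) (use P(2) e False in \<open>auto simp: V_def\<close>)
    also have "{x \<in> V. P e x y0 \<noteq> 0} = S"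
      using P0[OF e(1), of y0 x0] False e(1) by (auto simp: S_def)
    finally have S: "(?q - 1) * greedy_min (replicate r ?q) (d - e - 1) \<le> card S" .
    \<comment> \<open>The form in \<open>x\<close> has degree \<open>d - e \<ge> 1\<close> and
      projectively costs one unit less, which leaves exactly \<open>e\<close> units for the larger
      sizes.\<close>
    have "greedy_min (replicate r ?q @ D # zs) (d - 1)
        \<le> greedy_min (replicate r ?q) (d - 1 - e) * greedy_min (D # zs) e"
      by (rule greedy_min_append_le)
        (use srt zpos qD q d e False in \<open>auto simp: sorted_append\<close>)
    moreover have "greedy_min (D # zs) e = (D - e) * prod_list zs"
      by (rule greedy_min_Cons_less) (use e d zpos in auto)
    moreover have "d - 1 - e = d - e - 1" by simp
    ultimately have "(?q - 1) * greedy_min (replicate r ?q @ D # zs) (d - 1)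
        \<le> ((?q - 1) * greedy_min (replicate r ?q) (d - e - 1)) * ((D - e) * prod_list zs)"
      by (metis mult.assoc mult_le_mono2)
    also have "\<dots> \<le> card S * ((D - e) * prod_list zs)" using S by (rule mult_right_mono) simp
    finally show ?thesis .
  qed
  also have "\<dots> = (\<Sum>x\<in>S. (D - e) * prod_list zs)" by simp
  also have "\<dots> \<le> (\<Sum>x\<in>S. card {y \<in> T. poly_eval f (merge r x y) \<noteq> 0})"
    by (rule sum_mono) (rule each)
  also have "\<dots> = card (SIGMA x:S. {y \<in> T. poly_eval f (merge r x y) \<noteq> 0})"
    using finS finT by (subst card_SigmaI) auto
  also have "\<dots> \<le> card {(x, y) \<in> ?V \<times> T. poly_eval f (merge r x y) \<noteq> 0}"
  proof (rule card_mono)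
    show "finite {(x, y) \<in> ?V \<times> T. poly_eval f (merge r x y) \<noteq> 0}"
      by (rule finite_subset[of _ "V \<times> T"]) (use finV finT in auto)
  qed (auto simp: S_def)
  finally show ?thesis by (simp only: up)
qed

section \<open>Standard vectors and weights\<close>

definition std_vecs :: "nat \<Rightarrow> (nat \<Rightarrow> 'a::field set) \<Rightarrow> (nat \<Rightarrow> 'a) set" where
  "std_vecs n K = {a \<in> box {..n} K. \<exists>j\<le>n. a j = 1 \<and> (\<forall>i<j. a i = 0)}"

locale nested_fields =
  fixes K :: "nat \<Rightarrow> 'a::{finite,field} set" and n :: nat
  assumes n: "1 \<le> n"
    and subfield: "i \<le> n \<Longrightarrow> is_subfield (K i)"
    and nested: "i \<le> j \<Longrightarrow> j \<le> n \<Longrightarrow> K i \<subseteq> K j"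
begin

abbreviation nonzeros :: "'a mpoly \<Rightarrow> (nat \<Rightarrow> 'a) set" where
  "nonzeros f \<equiv> {a \<in> std_vecs n K. poly_eval f a \<noteq> 0}"

lemma finite_std_vecs: "finite (std_vecs n K)"
  unfolding std_vecs_def by (rule finite_subset[OF _ finite_box[of "{..n}" K]]) auto

lemma std_vecs_nonzero: "a \<in> std_vecs n K \<Longrightarrow> a \<in> nonzero_vecs n"
  by (auto simp: std_vecs_def box_def nonzero_vecs_def vecs_def)

lemma proj_rel_class:
  "a \<in> nonzero_vecs n \<Longrightarrow> proj_rel n `` {a} = {b. \<exists>c. c \<noteq> 0 \<and> b = (\<lambda>i. c * a i)}"
  by (auto simp: proj_rel_def nonzero_vecs_def vecs_def fun_eq_iff)

text \<open>Proportional vectors have their first nonzero entry at the same index, and if both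
  entries are 1, the factor is 1.\<close>

lemma std_rep_class:
  assumes a: "a \<in> std_vecs n K"
  shows "std_rep (proj_rel n `` {a}) = a"
proof -
  obtain j where j: "a j = 1" "\<forall>i<j. a i = 0" using a by (auto simp: std_vecs_def)
  show ?thesis
    unfolding std_rep_def proj_rel_class[OF std_vecs_nonzero[OF a]]
  proof (rule the_equality)
    show "a \<in> {b. \<exists>c. c \<noteq> 0 \<and> b = (\<lambda>i. c * a i)} \<and> (\<exists>j. a j = 1 \<and> (\<forall>i<j. a i = 0))"
      using j by (intro conjI CollectI exI[of _ j] exI[of _ "1::'a"]) auto
  next
    fix b assume "b \<in> {b. \<exists>c. c \<noteq> 0 \<and> b = (\<lambda>i. c * a i)} \<and> (\<exists>j. b j = 1 \<and> (\<forall>i<j. b i = 0))"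
    then obtain c k where c: "c \<noteq> 0" "b = (\<lambda>i. c * a i)" and k: "b k = 1" "\<forall>i<k. b i = 0" by auto
    have "j = k"
      using j k c by (metis linorder_neqE_nat mult_eq_0_iff zero_neq_one)
    then show "b = a" using j k c by simp
  qed
qed

text \<open>Dividing by the first nonzero entry \<open>a j\<close> keeps the coordinates in their
  fields: those before \<open>j\<close> are 0, and from \<open>j\<close> on the field
  \<open>K i\<close> contains \<open>K j\<close>.\<close>

lemma proj_product_eq: "proj_product n K = (\<lambda>a. proj_rel n `` {a}) ` std_vecs n K"
proof (intro equalityI subsetI)
  fix P assume "P \<in> proj_product n K"
  then obtain b a where b: "b \<in> nonzero_vecs n" "P = proj_rel n `` {b}"
    and a: "a \<in> P" "\<forall>i\<le>n. a i \<in> K i"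
    by (auto simp: proj_product_def proj_space_def quotient_def)
  obtain c where c: "c \<noteq> 0" "a = (\<lambda>i. c * b i)" using a(1) b proj_rel_class by auto
  have "\<exists>j. b j \<noteq> 0" using b(1) by (auto simp: nonzero_vecs_def)
  then have "\<exists>j. a j \<noteq> 0" using c by auto
  then obtain j where j: "a j \<noteq> 0" "\<forall>i<j. a i = 0"
    using exists_least_iff[of "\<lambda>j. a j \<noteq> 0"] by auto
  have avec: "a i = 0" if "n < i" for i using b(1) c that by (simp add: nonzero_vecs_def vecs_def)
  then have jn: "j \<le> n" using j(1) by (meson not_le)
  define s where "s = (\<lambda>i. a i / a j)"
  have "s i \<in> K i" if "i \<le> n" for i
  proof (cases "i < j")
    case True
    then show ?thesis using j is_subfieldD(1)[OF subfield[OF that]] by (simp add: s_def)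
  next
    case False
    then have "a j \<in> K i" using a(2) jn nested[of j i] that by auto
    then show ?thesis using a(2) that is_subfieldD(8)[OF subfield[OF that]] by (simp add: s_def)
  qed
  then have s: "s \<in> std_vecs n K" using j jn avec by (auto simp: std_vecs_def box_def s_def)
  have "P = proj_rel n `` {s}"
    unfolding b(2) proj_rel_class[OF b(1)] proj_rel_class[OF std_vecs_nonzero[OF s]]
  proof (intro equalityI subsetI)
    fix x assume "x \<in> {x. \<exists>c. c \<noteq> 0 \<and> x = (\<lambda>i. c * b i)}"
    then obtain e where "e \<noteq> 0" "x = (\<lambda>i. e * b i)" by auto
    then show "x \<in> {b. \<exists>c. c \<noteq> 0 \<and> b = (\<lambda>i. c * s i)}"
      using c j by (auto simp: s_def intro!: exI[of _ "e * b j"])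
  next
    fix x assume "x \<in> {b. \<exists>c. c \<noteq> 0 \<and> b = (\<lambda>i. c * s i)}"
    then obtain e where "e \<noteq> 0" "x = (\<lambda>i. e * s i)" by auto
    then show "x \<in> {x. \<exists>c. c \<noteq> 0 \<and> x = (\<lambda>i. c * b i)}"
      using c j by (auto simp: s_def intro!: exI[of _ "e / b j"])
  qed
  then show "P \<in> (\<lambda>a. proj_rel n `` {a}) ` std_vecs n K" using s by blast
next
  fix P assume "P \<in> (\<lambda>a. proj_rel n `` {a}) ` std_vecs n K"
  then obtain a where a: "a \<in> std_vecs n K" "P = proj_rel n `` {a}" by blast
  have "a \<in> P" unfolding a(2) proj_rel_class[OF std_vecs_nonzero[OF a(1)]] by (auto intro!: exI[of _ 1])
  then show "P \<in> proj_product n K"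
    using a std_vecs_nonzero[OF a(1)]
    by (auto simp: proj_product_def proj_space_def std_vecs_def box_def intro: quotientI)
qed

lemma weight_eval_map:
  "weight (proj_product n K) (eval_map (proj_product n K) f) = card (nonzeros f)"
proof -
  have "{P \<in> proj_product n K. eval_map (proj_product n K) f P \<noteq> 0} = (\<lambda>a. proj_rel n `` {a}) ` nonzeros f"
    by (auto simp: eval_map_def proj_product_eq std_rep_class)
  moreover have "inj_on (\<lambda>a. proj_rel n `` {a}) (nonzeros f)"
    by (rule inj_on_inverseI[of _ std_rep]) (simp add: std_rep_class)
  ultimately show ?thesis by (simp add: weight_def card_image)
qed

lemma eval_map_eq_0_iff: "eval_map (proj_product n K) f = (\<lambda>_. 0) \<longleftrightarrow> nonzeros f = {}"
proof -
  have "eval_map (proj_product n K) f = (\<lambda>_. 0) \<longleftrightarrow> (\<forall>P\<in>proj_product n K. poly_eval f (std_rep P) = 0)"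
    by (auto simp: eval_map_def fun_eq_iff)
  also have "\<dots> \<longleftrightarrow> (\<forall>a\<in>std_vecs n K. poly_eval f a = 0)"
    by (simp add: proj_product_eq std_rep_class)
  finally show ?thesis by auto
qed

lemma min_dist_eqI:
  assumes "f \<in> homogeneous_polys n d" "card (nonzeros f) = v" "0 < v"
    and "\<And>g. g \<in> homogeneous_polys n d \<Longrightarrow> nonzeros g \<noteq> {} \<Longrightarrow> v \<le> card (nonzeros g)"
  shows "min_dist n (proj_product n K) d = v"
proof -
  have eq: "{weight (proj_product n K) w |w. w \<in> eval_code n (proj_product n K) d \<and> w \<noteq> (\<lambda>_. 0)}
    = {card (nonzeros g) |g. g \<in> homogeneous_polys n d \<and> nonzeros g \<noteq> {}}"
  proof (intro equalityI subsetI)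
    fix v assume "v \<in> {weight (proj_product n K) w |w. w \<in> eval_code n (proj_product n K) d \<and> w \<noteq> (\<lambda>_. 0)}"
    then obtain g where "g \<in> homogeneous_polys n d" "v = weight (proj_product n K) (eval_map (proj_product n K) g)"
      "eval_map (proj_product n K) g \<noteq> (\<lambda>_. 0)" unfolding eval_code_def by blast
    then show "v \<in> {card (nonzeros g) |g. g \<in> homogeneous_polys n d \<and> nonzeros g \<noteq> {}}"
      unfolding weight_eval_map eval_map_eq_0_iff by blast
  next
    fix v assume "v \<in> {card (nonzeros g) |g. g \<in> homogeneous_polys n d \<and> nonzeros g \<noteq> {}}"
    then obtain g where g: "g \<in> homogeneous_polys n d" "v = card (nonzeros g)" "nonzeros g \<noteq> {}" by blast
    have "eval_map (proj_product n K) g \<in> eval_code n (proj_product n K) d"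
      unfolding eval_code_def using g(1) by (rule imageI)
    moreover have "v = weight (proj_product n K) (eval_map (proj_product n K) g)"
      "eval_map (proj_product n K) g \<noteq> (\<lambda>_. 0)"
      using g(2,3) by (simp_all only: weight_eval_map eval_map_eq_0_iff not_False_eq_True)
    ultimately show "v \<in> {weight (proj_product n K) w |w. w \<in> eval_code n (proj_product n K) d \<and> w \<noteq> (\<lambda>_. 0)}"
      by blast
  qed
  have "card (nonzeros g) \<le> card (std_vecs n K)" for g
    using finite_std_vecs by (intro card_mono) auto
  then have "finite {card (nonzeros g) |g. g \<in> homogeneous_polys n d \<and> nonzeros g \<noteq> {}}"
    by (rule_tac finite_subset[of _ "{..card (std_vecs n K)}"]) auto
  moreover have "nonzeros f \<noteq> {}" using assms(2,3) by (metis card.empty less_irrefl)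
  ultimately show ?thesis unfolding min_dist_def eq
    by (intro Min_eqI) (use assms in blast)+
qed

text \<open>This passes from vectors to projective points. The first nonzero entry of a vector in
  \<open>Y\<close> has index at most \<open>r\<close>, so it is one of the \<open>card F - 1\<close>
  nonzero elements of \<open>F\<close>, and dividing by it gives a standard vector outside the zeros
  of \<open>f\<close>.\<close>

lemma card_cone_le:
  assumes r: "r \<le> n" and F: "is_subfield F" "\<And>i. i \<in> {1..r} \<Longrightarrow> K i = F" "\<And>i. i \<in> {Suc r..n} \<Longrightarrow> F \<subseteq> K i"
    and f: "f \<in> homogeneous_polys n d"
    and Y: "\<And>a. a \<in> Y \<Longrightarrow> a \<in> box {..n} (\<lambda>i. if i \<le> r then F else K i) \<and> (\<exists>i\<le>r. a i \<noteq> 0) \<and> poly_eval f a \<noteq> 0"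
  shows "card Y \<le> (card F - 1) * card (nonzeros f)"
proof -
  let ?S = "\<lambda>(c, a) i. c * a i"
  have "Y \<subseteq> ?S ` ((F - {0}) \<times> nonzeros f)"
  proof
    fix a assume "a \<in> Y"
    note a = Y[OF this]
    have "\<exists>j. a j \<noteq> 0" using a by blast
    then obtain j where j: "a j \<noteq> 0" "\<forall>i<j. a i = 0"
      using exists_least_iff[of "\<lambda>j. a j \<noteq> 0"] by auto
    have jr: "j \<le> r" using a j(2) by (meson le_less_linear less_le_trans not_le)
    have "j \<in> {..n}" using jr r by simp
    then have "a j \<in> (if j \<le> r then F else K j)" using a unfolding box_def by blast
    then have ajF: "a j \<in> F" using jr by simp
    define s where "s = (\<lambda>i. a i / a j)"
    have "s i \<in> K i" if i: "i \<le> n" for i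
    proof -
      have ai: "a i \<in> (if i \<le> r then F else K i)" using a i unfolding box_def by blast
      consider "i = 0" | "i \<in> {1..r}" | "i \<in> {Suc r..n}" using i by force
      then show ?thesis
      proof cases
        \<comment> \<open>Coordinate 0 is either zero or the pivot itself, so after normalization it
          is 0 or 1 and lies in \<open>K 0\<close>, however small that field is.\<close>
        case 1
        then have "s i = 0 \<or> s i = 1" using j by (cases j) (auto simp: s_def)
        then show ?thesis using is_subfieldD(1,2)[OF subfield[OF i]] by auto
      next
        case 2
        then show ?thesis using ai ajF is_subfieldD(8)[OF F(1)] F(2)[OF 2] by (auto simp: s_def)
      next
        case 3
        then show ?thesis using ai ajF is_subfieldD(8)[OF subfield[OF i]] F(3)[OF 3] by (auto simp: s_def)
      qed
    qed
    then have "s \<in> std_vecs n K" using j jr r a by (auto simp: std_vecs_def box_def s_def)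
    moreover have as: "a = (\<lambda>i. a j * s i)" using j by (simp add: s_def)
    moreover have "poly_eval f s \<noteq> 0" using a poly_eval_scale[OF f, of "a j" s] as by auto
    ultimately show "a \<in> ?S ` ((F - {0}) \<times> nonzeros f)"
      using ajF j by (intro image_eqI[of _ _ "(a j, s)"]) auto
  qed
  then have "card Y \<le> card (?S ` ((F - {0}) \<times> nonzeros f))"
    using finite_std_vecs by (intro card_mono) auto
  also have "\<dots> \<le> card ((F - {0}) \<times> nonzeros f)"
    using finite_std_vecs by (intro card_image_le) auto
  also have "\<dots> = (card F - 1) * card (nonzeros f)"
    using is_subfieldD(1)[OF F(1)] by (simp add: card_cartesian_product)
  finally show ?thesis .
qed

text \<open>\<open>K 0\<close> is enlarged to the common field, the vector space bound is applied,
  and \<open>card_cone_le\<close> leads back to standard vectors. The factor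
  \<open>card ?F - 1\<close> cancels.\<close>

lemma nonzeros_ge_equal:
  assumes eq: "\<And>i. i \<in> {1..n} \<Longrightarrow> K i = K 1" and d: "1 \<le> d"
    and f: "f \<in> homogeneous_polys n d" and nz: "nonzeros f \<noteq> {}"
  shows "greedy_min (map (\<lambda>i. card (K i)) [1..<Suc n]) (d - 1) \<le> card (nonzeros f)"
proof -
  let ?F = "K 1"
  let ?V = "box {..n} (\<lambda>_. ?F)"
  have F: "is_subfield ?F" using subfield n by simp
  have K0: "K 0 \<subseteq> ?F" using nested[of 0 1] n by simp
  have KF: "K i \<subseteq> ?F" if "i \<le> n" for i using K0 eq[of i] that by (cases "i = 0") auto
  have "poly_eval f (\<lambda>_. 0) = 0" using poly_eval_scale[OF f, of 0 "\<lambda>_. 0"] d by (simp add: power_0_left)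
  then have nz0: "\<exists>i\<le>n. a i \<noteq> 0" if "a \<in> ?V" "poly_eval f a \<noteq> 0" for a
  proof (rule_tac ccontr)
    assume "\<not> (\<exists>i\<le>n. a i \<noteq> 0)"
    then have "a = (\<lambda>_. 0)" using that(1) by (auto simp: box_def fun_eq_iff)
    then show False using that(2) \<open>poly_eval f (\<lambda>_. 0) = 0\<close> by simp
  qed
  have "(card ?F - 1) * greedy_min (replicate n (card ?F)) (d - 1) \<le> card {x \<in> ?V. poly_eval f x \<noteq> 0}"
  proof (rule projective_nonzeros[OF F _ poly_fun_poly_eval[OF f] d])
    obtain a where "a \<in> nonzeros f" using nz by blast
    then show "\<exists>x\<in>?V. poly_eval f x \<noteq> 0" using KF by (auto simp: std_vecs_def box_def intro!: bexI[of _ a])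
  qed (use poly_eval_scale[OF f] in auto)
  also have "\<dots> \<le> (card ?F - 1) * card (nonzeros f)"
  proof (rule card_cone_le[OF order_refl F _ _ f])
    show "K i = ?F" if "i \<in> {1..n}" for i using eq that .
  qed (use nz0 in \<open>auto simp: box_def\<close>)
  finally have "greedy_min (replicate n (card ?F)) (d - 1) \<le> card (nonzeros f)"
    using card_subfield_ge_2[OF F] by simp
  moreover have "map (\<lambda>i. card (K i)) [1..<Suc n] = replicate n (card ?F)"
  proof -
    have "map (\<lambda>i. card (K i)) [1..<Suc n] = map (\<lambda>_. card ?F) [1..<Suc n]"
      by (intro map_cong refl arg_cong[of _ _ card] eq) auto
    then show ?thesis by (simp add: map_replicate_const del: upt_Suc)
  qed
  ultimately show ?thesis by simp
qed

text \<open>For \<open>x\<close> in \<open>E\<close> outside \<open>F\<close>, the elements 1 and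
  \<open>x\<close> are linearly independent over \<open>F\<close>, so their combinations are
  distinct.\<close>

lemma card_proper_extension:
  assumes F: "is_subfield F" and E: "is_subfield E" and "F \<subset> (E :: 'a set)"
  shows "(card F)\<^sup>2 \<le> card E"
proof -
  obtain x where x: "x \<in> E" "x \<notin> F" using assms(3) by blast
  have "inj_on (\<lambda>(a, b). a + b * x) (F \<times> F)"
  proof (rule inj_onI, clarify)
    fix a b a' b' assume m: "a \<in> F" "b \<in> F" "a' \<in> F" "b' \<in> F" and eq: "a + b * x = a' + b' * x"
    have "b = b'"
    proof (rule ccontr)
      assume ne: "b \<noteq> b'"
      have "x = (a' - a) / (b - b')" using eq ne by (simp add: field_simps)
      then show False using x(2) is_subfieldD(7,8)[OF F] m by metis
    qed
    then show "a = a' \<and> b = b'" using eq by simp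
  qed
  then have "card (F \<times> F) = card ((\<lambda>(a, b). a + b * x) ` (F \<times> F))" by (simp add: card_image)
  also have "\<dots> \<le> card E"
  proof (intro card_mono)
    have "a \<in> E" if "a \<in> F" for a using assms(3) that by blast
    then show "(\<lambda>(a, b). a + b * x) ` (F \<times> F) \<subseteq> E"
      using x(1) by (auto intro!: is_subfieldD(3,4)[OF E])
  qed simp
  finally show ?thesis by (simp add: card_cartesian_product power2_eq_square)
qed

text \<open>The first \<open>r + 1\<close> coordinates are enlarged to \<open>K 1\<close>, and the
  vectors are split at \<open>r\<close> by \<open>merge\<close>. The field of the jump is a proper
  extension of \<open>K 1\<close>, which supplies the quadratic size condition of
  \<open>nested_nonzeros\<close>.\<close>

lemma nonzeros_ge_jump:
  assumes r: "1 \<le> r" "r < n" and eq: "\<And>i. i \<in> {1..r} \<Longrightarrow> K i = K 1" and jump: "K r \<noteq> K (Suc r)"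
    and d: "1 \<le> d" "d < card (K (Suc r))"
    and f: "f \<in> homogeneous_polys n d" and nz: "nonzeros f \<noteq> {}"
  shows "greedy_min (map (\<lambda>i. card (K i)) [1..<Suc n]) (d - 1) \<le> card (nonzeros f)"
proof -
  let ?F = "K 1"
  let ?V = "box {..r} (\<lambda>_. ?F)" and ?T = "box {Suc r..n} K"
  have F: "is_subfield ?F" using subfield n by simp
  have FK: "?F \<subseteq> K i" if "i \<in> {Suc r..n}" for i using nested[of 1 i] that by simp
  have KF: "K i \<subseteq> ?F" if "i \<le> r" for i using nested[of 0 1] n eq[of i] that by (cases "i = 0") auto
  have Kr: "K r = ?F" using eq[of r] r by simp
  define Y where "Y = {(x, y) \<in> (?V - {\<lambda>_. 0}) \<times> ?T. poly_eval f (merge r x y) \<noteq> 0}"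
  have "(card ?F - 1) * greedy_min (replicate r (card ?F) @ map (\<lambda>i. card (K i)) [Suc r..<Suc n]) (d - 1) \<le> card Y"
    unfolding Y_def
  proof (rule nested_nonzeros[where K = K, OF F _ r _ _ _ d f])
    show "sorted (map (\<lambda>i. card (K i)) [Suc r..<Suc n])"
      unfolding sorted_map
    proof (rule sorted_wrt_mono_rel[OF _ sorted_upt])
      fix i j assume "i \<in> set [Suc r..<Suc n]" "j \<in> set [Suc r..<Suc n]" "i \<le> j"
      then have "K i \<subseteq> K j" by (intro nested) (auto simp: less_Suc_eq_le simp del: upt_Suc)
      then show "card (K i) \<le> card (K j)" by (intro card_mono) auto
    qed
    show "(card ?F)\<^sup>2 \<le> card (K (Suc r))"
      using card_proper_extension[OF F subfield[of "Suc r"]] FK[of "Suc r"] r jump Kr by auto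
    show "is_subfield (K i) \<and> finite (K i) \<and> K (Suc r) \<subseteq> K i" if "i \<in> {Suc r..n}" for i
      using subfield[of i] nested[of "Suc r" i] that by simp
    obtain a where a: "a \<in> nonzeros f" using nz by blast
    define x y where "x = (\<lambda>i. if i \<le> r then a i else 0)" and "y = (\<lambda>i. if i \<le> r then 0 else a i)"
    have "merge r x y = a" by (auto simp: merge_def x_def y_def)
    moreover have "x \<in> ?V" "y \<in> ?T"
    proof -
      have aK: "a i \<in> K i" if "i \<le> n" for i using a that by (simp add: std_vecs_def box_def)
      have "a i \<in> ?F" if "i \<le> r" for i using KF[OF that] aK[of i] that r by auto
      then show "x \<in> ?V" by (simp add: box_def x_def)
      show "y \<in> ?T" using aK a by (auto simp: std_vecs_def box_def y_def)
    qed
    ultimately show "\<exists>x\<in>?V. \<exists>y\<in>?T. poly_eval f (merge r x y) \<noteq> 0" using a by auto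
  qed simp
  also have "card Y = card ((\<lambda>(x, y). merge r x y) ` Y)"
  proof (rule card_image[symmetric], rule inj_onI, clarify)
    fix x y x' y' assume m: "(x, y) \<in> Y" "(x', y') \<in> Y" and eq: "merge r x y = merge r x' y'"
    have "x i = x' i \<and> y i = y' i" for i
      using m fun_cong[OF eq, of i] by (cases "i \<le> r") (auto simp: Y_def box_def merge_def)
    then show "x = x' \<and> y = y'" by auto
  qed
  also have "\<dots> \<le> (card ?F - 1) * card (nonzeros f)"
  proof (rule card_cone_le[OF _ F eq FK f])
    fix a assume "a \<in> (\<lambda>(x, y). merge r x y) ` Y"
    then obtain x y where a: "a = merge r x y" "(x, y) \<in> Y" by auto
    have "\<exists>i. x i \<noteq> 0" using a(2) by (auto simp: Y_def)
    then have "\<exists>i\<le>r. a i \<noteq> 0" using a by (auto simp: Y_def box_def merge_def)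
    then show "a \<in> box {..n} (\<lambda>i. if i \<le> r then ?F else K i) \<and> (\<exists>i\<le>r. a i \<noteq> 0) \<and> poly_eval f a \<noteq> 0"
      using a r by (auto simp: Y_def box_def merge_def)
  qed (use r in auto)
  finally have "greedy_min (replicate r (card ?F) @ map (\<lambda>i. card (K i)) [Suc r..<Suc n]) (d - 1) \<le> card (nonzeros f)"
    using card_subfield_ge_2[OF F] by simp
  moreover have "[1..<Suc n] = [1..<Suc r] @ [Suc r..<Suc n]"
    using upt_add_eq_append[of 1 "Suc r" "n - r"] r by simp
  moreover have "map (\<lambda>i. card (K i)) [1..<Suc r] = replicate r (card ?F)"
  proof -
    have "map (\<lambda>i. card (K i)) [1..<Suc r] = map (\<lambda>_. card ?F) [1..<Suc r]"
      by (intro map_cong refl arg_cong[of _ _ card] eq) auto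
    then show ?thesis by (simp add: map_replicate_const del: upt_Suc)
  qed
  ultimately show ?thesis by (simp del: upt_Suc)
qed

end

section \<open>Forms of small weight\<close>

text \<open>Only values of forms matter for the weight, so the form of small weight is assembled as
  a function from pointwise sums and products.\<close>

definition hom_fun :: "nat \<Rightarrow> nat \<Rightarrow> ((nat \<Rightarrow> 'a::field) \<Rightarrow> 'a) set" where
  "hom_fun n d = poly_eval ` homogeneous_polys n d"

lemma monom_eval_superset:
  assumes "finite S" "Poly_Mapping.keys m \<subseteq> S"
  shows "monom_eval m x = (\<Prod>i\<in>S. x i ^ Poly_Mapping.lookup m i)"
  unfolding monom_eval_def using assms by (intro prod.mono_neutral_left) (auto simp: in_keys_iff)

lemma poly_eval_superset:
  assumes "finite S" "Poly_Mapping.keys f \<subseteq> S"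
  shows "poly_eval f x = (\<Sum>m\<in>S. Poly_Mapping.lookup f m * monom_eval m x)"
  unfolding poly_eval_monom_eval using assms by (intro sum.mono_neutral_left) (auto simp: in_keys_iff)

lemma monom_eval_plus: "monom_eval (m + m') x = monom_eval m x * monom_eval m' x"
proof -
  let ?S = "Poly_Mapping.keys m \<union> Poly_Mapping.keys m'"
  have "Poly_Mapping.keys (m + m') \<subseteq> ?S" by (rule Poly_Mapping.keys_add)
  then show ?thesis
    by (simp add: monom_eval_superset[of ?S] lookup_add power_add prod.distrib)
qed

lemma degree_plus:
  fixes m m' :: "nat \<Rightarrow>\<^sub>0 nat"
  shows "(\<Sum>i\<in>Poly_Mapping.keys (m + m'). Poly_Mapping.lookup (m + m') i)
    = (\<Sum>i\<in>Poly_Mapping.keys m. Poly_Mapping.lookup m i) + (\<Sum>i\<in>Poly_Mapping.keys m'. Poly_Mapping.lookup m' i)"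
proof -
  let ?S = "Poly_Mapping.keys m \<union> Poly_Mapping.keys m'"
  have sup: "(\<Sum>i\<in>Poly_Mapping.keys p. Poly_Mapping.lookup p i) = (\<Sum>i\<in>?S. Poly_Mapping.lookup p i)"
    if "Poly_Mapping.keys p \<subseteq> ?S" for p :: "nat \<Rightarrow>\<^sub>0 nat"
    using that by (intro sum.mono_neutral_left) (auto simp: in_keys_iff)
  show ?thesis
    using sup[OF Poly_Mapping.keys_add] sup[of m] sup[of m'] by (simp add: lookup_add sum.distrib)
qed

lemma hom_fun_add:
  assumes "F \<in> hom_fun n d" "G \<in> hom_fun n d"
  shows "(\<lambda>x. F x + G x) \<in> hom_fun n d"
proof -
  obtain f g where f: "f \<in> homogeneous_polys n d" "F = poly_eval f"
    and g: "g \<in> homogeneous_polys n d" "G = poly_eval g" using assms by (auto simp: hom_fun_def)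
  let ?S = "Poly_Mapping.keys f \<union> Poly_Mapping.keys g"
  have sub: "Poly_Mapping.keys (f + g) \<subseteq> ?S" by (rule Poly_Mapping.keys_add)
  then have "(\<lambda>x. F x + G x) = poly_eval (f + g)"
    by (simp add: f g fun_eq_iff poly_eval_superset[of ?S] lookup_add distrib_right sum.distrib)
  moreover have "f + g \<in> homogeneous_polys n d" using f g sub by (auto simp: homogeneous_polys_def)
  ultimately show ?thesis by (simp add: hom_fun_def)
qed

lemma hom_fun_sum:
  "(\<And>s. s \<in> S \<Longrightarrow> f s \<in> hom_fun n d) \<Longrightarrow> (\<lambda>x. \<Sum>s\<in>S. f s x) \<in> hom_fun n d"
proof (induction S rule: infinite_finite_induct)
  case (insert s S)
  then show ?case by (simp add: hom_fun_add)
qed (auto simp: hom_fun_def homogeneous_polys_def poly_eval_def fun_eq_iff intro!: image_eqI[of _ _ 0])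

lemma hom_fun_monom:
  assumes "Poly_Mapping.keys m \<subseteq> {..n}" "(\<Sum>i\<in>Poly_Mapping.keys m. Poly_Mapping.lookup m i) = d"
  shows "(\<lambda>x. c * monom_eval m x) \<in> hom_fun n d"
proof -
  have "(\<lambda>x. c * monom_eval m x) = poly_eval (Poly_Mapping.single m c)"
    by (auto simp: poly_eval_monom_eval fun_eq_iff)
  moreover have "Poly_Mapping.single m c \<in> homogeneous_polys n d"
    using assms by (auto simp: homogeneous_polys_def split: if_splits)
  ultimately show ?thesis by (simp add: hom_fun_def)
qed

lemma hom_fun_const: "(\<lambda>_. c) \<in> hom_fun n 0"
  using hom_fun_monom[of 0 n 0 c] by (simp add: monom_eval_def)

lemma hom_fun_var: "i \<le> n \<Longrightarrow> (\<lambda>x. x i) \<in> hom_fun n 1"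
  using hom_fun_monom[of "Poly_Mapping.single i 1" n 1 1] by (simp add: monom_eval_def)

lemma hom_fun_mult:
  assumes "F \<in> hom_fun n d" "G \<in> hom_fun n e"
  shows "(\<lambda>x. F x * G x) \<in> hom_fun n (d + e)"
proof -
  obtain f g where f: "f \<in> homogeneous_polys n d" "F = poly_eval f"
    and g: "g \<in> homogeneous_polys n e" "G = poly_eval g" using assms by (auto simp: hom_fun_def)
  have "(\<lambda>x. F x * G x) = (\<lambda>x. \<Sum>m\<in>Poly_Mapping.keys f. \<Sum>m'\<in>Poly_Mapping.keys g.
      (Poly_Mapping.lookup f m * Poly_Mapping.lookup g m') * monom_eval (m + m') x)"
    by (simp add: f g poly_eval_monom_eval sum_product monom_eval_plus mult_ac)
  also have "\<dots> \<in> hom_fun n (d + e)"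
  proof (intro hom_fun_sum hom_fun_monom)
    fix m m' assume m: "m \<in> Poly_Mapping.keys f" "m' \<in> Poly_Mapping.keys g"
    then show "Poly_Mapping.keys (m + m') \<subseteq> {..n}"
      using f(1) g(1) Poly_Mapping.keys_add[of m m'] by (fastforce simp: homogeneous_polys_def)
    show "(\<Sum>i\<in>Poly_Mapping.keys (m + m'). Poly_Mapping.lookup (m + m') i) = d + e"
      using m f(1) g(1) by (simp add: degree_plus homogeneous_polys_def)
  qed
  finally show ?thesis .
qed

lemma hom_fun_power: "F \<in> hom_fun n d \<Longrightarrow> (\<lambda>x. F x ^ k) \<in> hom_fun n (k * d)"
  by (induction k) (auto simp: hom_fun_const intro: hom_fun_mult)

lemma hom_fun_prod:
  "finite S \<Longrightarrow> (\<And>s. s \<in> S \<Longrightarrow> f s \<in> hom_fun n (e s)) \<Longrightarrow> (\<lambda>x. \<Prod>s\<in>S. f s x) \<in> hom_fun n (\<Sum>s\<in>S. e s)"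
  by (induction S rule: finite_induct) (auto simp: hom_fun_const intro: hom_fun_mult)

lemma hom_fun_diff_scaled:
  assumes "F \<in> hom_fun n d" "G \<in> hom_fun n d"
  shows "(\<lambda>x. F x - c * G x) \<in> hom_fun n d"
  using hom_fun_add[OF assms(1) hom_fun_mult[OF hom_fun_const[of "- c"] assms(2), simplified]] by simp

text \<open>Multiplication by \<open>a\<close> permutes the nonzero elements of \<open>F\<close>;
  compare the products over both arrangements.\<close>

lemma subfield_fermat:
  fixes F :: "'a::field set"
  assumes F: "is_subfield F" "finite F" and a: "a \<in> F" "a \<noteq> 0"
  shows "a ^ (card F - 1) = 1"
proof -
  let ?U = "F - {0}"
  note sf = is_subfieldD[OF F(1)]
  have "(\<lambda>x. a * x) ` ?U \<subseteq> ?U" using a sf by auto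
  moreover have inj: "inj_on (\<lambda>x. a * x) ?U" using a by (auto simp: inj_on_def)
  ultimately have "bij_betw (\<lambda>x. a * x) ?U ?U"
    using F by (simp add: bij_betw_def endo_inj_surj)
  then have "(\<Prod>x\<in>?U. a * x) = \<Prod>?U" by (rule prod.reindex_bij_betw)
  then have "a ^ card ?U * \<Prod>?U = 1 * \<Prod>?U" by (simp add: prod.distrib)
  moreover have "\<Prod>?U \<noteq> 0" using F by simp
  moreover have "card ?U = card F - 1" using F sf by simp
  ultimately show ?thesis by (metis mult_cancel_right)
qed

section \<open>Extremal forms and the resulting minimum distances\<close>

context nested_fields
begin

text \<open>The power of X_0 forces the pivot to index 0, the binomials force coordinates 1 to
  \<open>k\<close> to be zero, and the linear forms keep coordinate \<open>k + 1\<close> out of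
  \<open>C\<close>; the others are free. The exponent \<open>s\<close> is left open so that
  arbitrarily high degrees can be reached.\<close>

lemma exists_small_nonzeros:
  assumes s: "1 \<le> s" and k: "k < n" and C: "C \<subseteq> K (Suc k)"
  shows "\<exists>f \<in> homogeneous_polys n (s + (\<Sum>i=1..k. card (K i) - 1) + card C).
    card (nonzeros f) = (card (K (Suc k)) - card C) * (\<Prod>i=k+2..n. card (K i))"
proof -
  let ?d = "s + (\<Sum>i=1..k. card (K i) - 1) + card C"
  define Q where "Q x = x 0 ^ s * (\<Prod>i=1..k. x 0 ^ (card (K i) - 1) - 1 * x i ^ (card (K i) - 1))
    * (\<Prod>c\<in>C. x (Suc k) - c * x 0)" for x :: "nat \<Rightarrow> 'a"
  have pow: "(\<lambda>x. x i ^ e) \<in> hom_fun n e" if "i \<le> n" for i e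
    using hom_fun_power[OF hom_fun_var[OF that], of e] by simp
  have "Q \<in> hom_fun n (s + (\<Sum>i=1..k. card (K i) - 1) + (\<Sum>c\<in>C. 1))"
    unfolding Q_def[abs_def]
    by (intro hom_fun_mult hom_fun_prod hom_fun_diff_scaled pow hom_fun_var) (use k in auto)
  then have "Q \<in> hom_fun n ?d" by simp
  then obtain f where f: "f \<in> homogeneous_polys n ?d" "poly_eval f = Q" by (auto simp: hom_fun_def)
  define B where "B i = (if i = 0 then {1} else if i \<le> k then {0} else if i = Suc k then K i - C else K i)" for i
  have "nonzeros f = box {..n} B"
  proof (intro equalityI subsetI)
    fix a assume "a \<in> nonzeros f"
    then have a: "a \<in> box {..n} K" "Q a \<noteq> 0" "\<exists>j\<le>n. a j = 1 \<and> (\<forall>i<j. a i = 0)"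
      by (auto simp: std_vecs_def f)
    have "a 0 \<noteq> 0" using a(2) s by (auto simp: Q_def)
    then have a0: "a 0 = 1" using a(3) by (metis gr0I)
    have "a i = 0" if "i \<in> {1..k}" for i
    proof (rule ccontr)
      assume "a i \<noteq> 0"
      moreover have "a i \<in> K i" using a(1) that k by (simp add: box_def)
      ultimately have "a i ^ (card (K i) - 1) = 1"
        using subfield_fermat[OF subfield[of i]] that k by simp
      moreover have "1 - a i ^ (card (K i) - 1) \<noteq> 0" using a(2) that by (simp add: Q_def a0)
      ultimately show False by simp
    qed
    moreover have "a (Suc k) \<notin> C" using a(2) by (auto simp: Q_def a0)
    ultimately show "a \<in> box {..n} B" using a(1) a0 by (auto simp: box_def B_def)
  next
    fix a assume a: "a \<in> box {..n} B"
    have aB: "a i \<in> B i" if "i \<le> n" for i using a that by (simp add: box_def)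
    have a0: "a 0 = 1" using aB[of 0] by (simp add: B_def)
    have ai: "a i = 0" if "i \<in> {1..k}" for i using aB[of i] that k by (simp add: B_def)
    have ak: "a (Suc k) \<notin> C" using aB[of "Suc k"] k by (simp add: B_def)
    have "B i \<subseteq> K i" if "i \<le> n" for i using is_subfieldD(1,2)[OF subfield[OF that]] by (auto simp: B_def)
    then have "a \<in> box {..n} K" using a by (auto simp: box_def)
    moreover have "card (K i) - 1 \<noteq> 0" if "i \<le> n" for i
      using card_subfield_ge_2[OF subfield[OF that]] by simp
    then have "Q a \<noteq> 0" using a0 ai ak k by (auto simp: Q_def power_0_left)
    ultimately show "a \<in> nonzeros f" using a0 by (auto simp: std_vecs_def f intro!: exI[of _ 0])
  qed
  then have "card (nonzeros f) = (\<Prod>i\<in>{..n}. card (B i))" by (simp add: card_box)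
  also have "\<dots> = (\<Prod>i\<in>insert (Suc k) {k+2..n}. card (B i))"
    by (rule prod.mono_neutral_right) (use k in \<open>auto simp: B_def\<close>)
  also have "\<dots> = card (B (Suc k)) * (\<Prod>i=k+2..n. card (K i))"
    by (simp add: B_def)
  also have "card (B (Suc k)) = card (K (Suc k)) - card C" using C by (simp add: B_def card_Diff_subset)
  finally show ?thesis using f(1) by blast
qed

text \<open>With \<open>k = n - 1\<close> and all nonzero elements of \<open>K n\<close> excluded,
  only the point (1 : 0 : ... : 0) survives; the surplus degree goes into the power of X_0.\<close>

lemma min_dist_eq_1:
  assumes "(\<Sum>i=1..n. card (K i) - 1) < d"
  shows "min_dist n (proj_product n K) d = 1"
proof -
  have n1: "Suc (n - 1) = n" using n by simp
  let ?C = "K n - {0}"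
  have C: "card ?C = card (K n) - 1" using is_subfieldD(1)[OF subfield[of n]] by simp
  have sum: "(\<Sum>i=1..n. card (K i) - 1) = (\<Sum>i=1..n-1. card (K i) - 1) + (card (K n) - 1)"
    using sum.cl_ivl_Suc[of "\<lambda>i. card (K i) - 1" 1 "n - 1"] n by (simp add: n1)
  obtain f where f: "f \<in> homogeneous_polys n ((d - (\<Sum>i=1..n. card (K i) - 1)) + (\<Sum>i=1..n-1. card (K i) - 1) + card ?C)"
    "card (nonzeros f) = (card (K n) - card ?C) * (\<Prod>i=n-1+2..n. card (K i))"
  proof -
    have "1 \<le> d - (\<Sum>i=1..n. card (K i) - 1)" "n - 1 < n" "?C \<subseteq> K (Suc (n - 1))"
      using assms n n1 by auto
    from exists_small_nonzeros[OF this] show ?thesis using that by (auto simp only: n1)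
  qed
  have "card (nonzeros f) = 1"
    using f(2) card_subfield_ge_2[OF subfield[of n]] n unfolding C by simp
  moreover have "f \<in> homogeneous_polys n d" using f(1) assms C sum by simp
  ultimately show ?thesis
    by (intro min_dist_eqI) (auto simp: Suc_le_eq card_gt_0_iff finite_std_vecs)
qed

text \<open>The form with \<open>s = 1\<close> and any \<open>l\<close>-element set \<open>C\<close>
  has degree \<open>d\<close>, and its weight equals the greedy value as evaluated by
  \<open>greedy_min_explicit\<close>.\<close>

lemma min_dist_eq:
  assumes lower: "\<And>f. f \<in> homogeneous_polys n d \<Longrightarrow> nonzeros f \<noteq> {} \<Longrightarrow>
      greedy_min (map (\<lambda>i. card (K i)) [1..<Suc n]) (d - 1) \<le> card (nonzeros f)"
    and d: "1 \<le> d" "d - 1 = (\<Sum>i=1..k. card (K i) - 1) + l" and k: "k \<le> n - 1" and l: "l < card (K (k + 1)) - 1"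
  shows "min_dist n (proj_product n K) d = (card (K (k + 1)) - l) * (\<Prod>i=k+2..n. card (K i))"
proof -
  have kn: "k < n" using k n by simp
  obtain C where C: "C \<subseteq> K (Suc k)" "card C = l"
    by (rule obtain_subset_with_card_n[of l "K (Suc k)"]) (use l in auto)
  obtain f where f: "f \<in> homogeneous_polys n (1 + (\<Sum>i=1..k. card (K i) - 1) + card C)"
    "card (nonzeros f) = (card (K (Suc k)) - card C) * (\<Prod>i=k+2..n. card (K i))"
    using exists_small_nonzeros[of 1 k C] kn C by auto
  have ivl: "{1..<1+k} = {1..k}" "{1+k+1..<Suc n} = {k+2..n}" by auto
  have "greedy_min (map (\<lambda>i. card (K i)) [1..<Suc n]) ((\<Sum>i=1..<1+k. card (K i) - 1) + l)
      = (card (K (1 + k)) - l) * (\<Prod>i=1+k+1..<Suc n. card (K i))"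
    by (rule greedy_min_explicit) (use kn l in auto)
  then have g: "greedy_min (map (\<lambda>i. card (K i)) [1..<Suc n]) (d - 1)
      = (card (K (k + 1)) - l) * (\<Prod>i=k+2..n. card (K i))"
    unfolding ivl d(2) by (simp only: add.commute)
  have "0 < card (K i)" if "i \<le> n" for i using card_subfield_ge_2[OF subfield[OF that]] by simp
  then have pos: "0 < (\<Prod>i=k+2..n. card (K i))" by (intro prod_pos) auto
  have "1 + (\<Sum>i=1..k. card (K i) - 1) + card C = d" using d C(2) by linarith
  then have fd: "f \<in> homogeneous_polys n d" using f(1) by (simp only:)
  show ?thesis
  proof (rule min_dist_eqI[OF fd])
    show "card (nonzeros f) = (card (K (k + 1)) - l) * (\<Prod>i=k+2..n. card (K i))"
      using f(2) C by simp
    show "0 < (card (K (k + 1)) - l) * (\<Prod>i=k+2..n. card (K i))" using pos l by simp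
  qed (use lower g in simp)
qed

end

text \<open>The half-open intervals between consecutive partial sums cover the range below the total
  without overlap; \<open>k\<close> is the index of the interval that contains
  \<open>t\<close>.\<close>

lemma ex1_partial_sum_remainder:
  fixes c :: "nat \<Rightarrow> nat"
  assumes t: "t < (\<Sum>i=1..n. c i)"
  shows "\<exists>!(k, l). k \<le> n - 1 \<and> l < c (k + 1) \<and> t = (\<Sum>i=1..k. c i) + l"
proof -
  let ?G = "\<lambda>k. \<Sum>i=1..k. c i"
  define k where "k = (LEAST k. t < ?G (Suc k))"
  have n: "n \<noteq> 0" using t by (intro notI) simp
  then have ex: "t < ?G (Suc (n - 1))" using t by simp
  have kn: "k \<le> n - 1" unfolding k_def by (rule Least_le) (rule ex)
  have k: "t < ?G (Suc k)" unfolding k_def by (rule LeastI) (rule ex)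
  have Gk: "?G k \<le> t"
  proof (cases k)
    case (Suc j)
    then have "j < (LEAST k. t < ?G (Suc k))" using k_def by simp
    from not_less_Least[OF this] show ?thesis using Suc by simp
  qed simp
  have uniq: "k' = k \<and> l' = t - ?G k" if H: "l' < c (k' + 1)" "t = ?G k' + l'" for k' l'
  proof -
    have mono: "?G i \<le> ?G j" if "i \<le> j" for i j using that by (intro sum_mono2) auto
    have k': "t < ?G (Suc k')" using H by simp
    have "k' = k"
    proof (rule linorder_cases[of k' k])
      assume "k' < k"
      then show ?thesis using mono[of "Suc k'" k] k' Gk by simp
    next
      assume "k < k'"
      then show ?thesis using mono[of "Suc k" k'] k H(2) by simp
    qed
    then show ?thesis using H(2) by simp
  qed
  show ?thesis
  proof (rule ex1I[of _ "(k, t - ?G k)"])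
    show "case (k, t - ?G k) of (k, l) \<Rightarrow> k \<le> n - 1 \<and> l < c (k + 1) \<and> t = ?G k + l"
      using kn k Gk by simp
  qed (use uniq in auto)
qed

theorem theorem3p8:
  fixes K :: "nat \<Rightarrow> 'a::{finite,field} set" and n d :: nat
  assumes "n \<ge> 1"
    and "\<forall>i\<le>n. is_subfield (K i)"
    and "\<forall>i<n. K i \<subseteq> K (Suc i)"
  shows
    "((\<Sum>i=1..n. (card (K i) - 1)) < d \<longrightarrow> min_dist n (proj_product n K) d = 1) \<and>
     (((\<forall>i\<in>{1..n}. card (K i) = card (K 1)) \<and> 1 \<le> d \<and> d \<le> (\<Sum>i=1..n. (card (K i) - 1)) \<or>
       (\<exists>r. 1 \<le> r \<and> r + 1 \<le> n \<and> card (K 1) = card (K r) \<and> card (K r) < card (K (r + 1)) \<and>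
            1 \<le> d \<and> d < card (K (r + 1))))
      \<longrightarrow>
      (\<exists>!(k, l). k \<le> n - 1 \<and> l < card (K (k + 1)) - 1 \<and>
                 d - 1 = (\<Sum>i=1..k. (card (K i) - 1)) + l) \<and>
      (\<forall>k l. k \<le> n - 1 \<and> l < card (K (k + 1)) - 1 \<and>
             d - 1 = (\<Sum>i=1..k. (card (K i) - 1)) + l
        \<longrightarrow> min_dist n (proj_product n K) d
              = (card (K (k + 1)) - l) * (\<Prod>i=k+2..n. card (K i))))"
proof -
  interpret nested_fields K n
  proof
    show "K i \<subseteq> K j" if "i \<le> j" "j \<le> n" for i j
      using that by (induction j rule: dec_induct) (use assms(3) in \<open>auto simp: Suc_le_eq\<close>)
  qed (use assms in auto)
  define lower where "lower \<longleftrightarrow> (\<forall>f. f \<in> homogeneous_polys n d \<longrightarrow> nonzeros f \<noteq> {} \<longrightarrow>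
      greedy_min (map (\<lambda>i. card (K i)) [1..<Suc n]) (d - 1) \<le> card (nonzeros f))"
  \<comment> \<open>The hypotheses speak of sizes only; by nesting, fields of equal size
    coincide.\<close>
  have eqI: "K i = K 1" if "i \<in> {1..n}" "card (K i) \<le> card (K 1)" for i
    using card_seteq[OF _ nested[of 1 i]] that by auto
  have "1 \<le> d \<and> d - 1 < (\<Sum>i=1..n. card (K i) - 1) \<and> lower"
    if H: "(\<forall>i\<in>{1..n}. card (K i) = card (K 1)) \<and> 1 \<le> d \<and> d \<le> (\<Sum>i=1..n. (card (K i) - 1)) \<or>
       (\<exists>r. 1 \<le> r \<and> r + 1 \<le> n \<and> card (K 1) = card (K r) \<and> card (K r) < card (K (r + 1)) \<and>
            1 \<le> d \<and> d < card (K (r + 1)))"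
    using H
  proof (elim disjE exE conjE)
    assume eq: "\<forall>i\<in>{1..n}. card (K i) = card (K 1)" and d: "1 \<le> d" "d \<le> (\<Sum>i=1..n. (card (K i) - 1))"
    have "K i = K 1" if "i \<in> {1..n}" for i using eqI[OF that] eq that by (metis order_refl)
    then have lower unfolding lower_def by (intro allI impI nonzeros_ge_equal d(1))
    then show ?thesis using d by linarith
  next
    fix r assume r: "1 \<le> r" "r + 1 \<le> n" "card (K 1) = card (K r)" "card (K r) < card (K (r + 1))"
      and d: "1 \<le> d" "d < card (K (r + 1))"
    have eq: "K i = K 1" if "i \<in> {1..r}" for i
    proof (rule eqI)
      show "i \<in> {1..n}" using that r by simp
      have "K i \<subseteq> K r" using that r by (intro nested) auto
      then show "card (K i) \<le> card (K 1)" unfolding r(3) by (intro card_mono) auto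
    qed
    have "K r \<noteq> K (Suc r)" using r(4) by auto
    then have lower unfolding lower_def
      using r d by (intro allI impI nonzeros_ge_jump[of r] eq) auto
    \<comment> \<open>\<open>d - 1\<close> is less than this single summand, hence less than the
      whole sum, which is the condition for the decomposition to exist.\<close>
    moreover have "card (K (r + 1)) - 1 \<le> (\<Sum>i=1..n. card (K i) - 1)"
      using r by (intro member_le_sum) auto
    ultimately show ?thesis using d by linarith
  qed
  note hyp = this
  show ?thesis
  proof (intro conjI impI allI, goal_cases)
    case 1
    then show ?case by (rule min_dist_eq_1)
  next
    case 2
    then show ?case using hyp by (intro ex1_partial_sum_remainder) blast
  next
    case (3 k l)
    then have "1 \<le> d" lower using hyp by blast+
    then show ?case using 3(2) unfolding lower_def by (intro min_dist_eq) blast+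
  qed
qed

end
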